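(* Let $\mathbb U$ be the Urysohn space and $G=\operatorname{Iso}(\mathbb U)$ its isometry group, endowed with the topology of pointwise convergence. Then the greatest equivariant compactification of the $G$-space $\mathbb U$ is (equivalent to) the Gromov compactification of $\mathbb U$, which is not metrizable.
   Context: Urysohn space: $\mathbb U$ is the unique (up to isometry) Polish (separable complete) metric space of infinite diameter that is finitely injective, i.e. for every pair of finite metric spaces $K\subseteq L$, every isometric embedding $K\to\mathbb U$ extends to an isometric embedding $L\to\mathbb U$. Equivariant compactifications: a $G$-space is a Tychonoff space $X$ with a continuous left action of the topological group $G$. An equivariant compactification of $X$ is a compact Hausdorff $G$-space $K$ together with a continuous $G$-equivariant map $\nu\colon X\to K$ with dense image. A compactification $\nu'\colon X\to K'$ is a factor of $\nu\colon X\to K$ if there is a continuous $\pi\colon K\to K'$ with $\pi\circ\nu=\nu'$; two compactifications are equivalent if each is a factor of the other. The greatest equivariant compactification $\beta_G\colon X\to\beta_GX$ is the one of which every equivariant compactification is a factor. Gromov compactification of a metric space $(X,d)$ (not necessarily bounded): let $\mathcal U_{w,d}$ be the initial uniformity on $X$ generated by the functions $f_z(x)=d(x,z)$, $z\in X$. The Gromov compactification is the Samuel compactification of $(X,\mathcal U_{w,d})$, i.e. the compactification corresponding to the algebra of all bounded $\mathcal U_{w,d}$-uniformly continuous real functions on $X$. *)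

theory Defs
  imports "HOL-Analysis.Analysis" "HOL-Algebra.Group_Action"
begin

section \<open>The Urysohn space and its isometry group\<close>

definition isometric_embedding ::
    "'a set \<Rightarrow> ('a \<Rightarrow> 'a \<Rightarrow> real) \<Rightarrow> 'b set \<Rightarrow> ('b \<Rightarrow> 'b \<Rightarrow> real) \<Rightarrow> ('a \<Rightarrow> 'b) \<Rightarrow> bool" where
  "isometric_embedding A dA B dB f \<longleftrightarrow>
     f \<in> A \<rightarrow> B \<and> (\<forall>x\<in>A. \<forall>y\<in>A. dB (f x) (f y) = dA x y)"

text \<open>Every finite metric space is isometric to one whose points are natural numbers, so
  letting the finite spaces range over subsets of \<^typ>\<open>nat\<close> loses no generality.\<close>

definition finitely_injective :: "'a set \<Rightarrow> ('a \<Rightarrow> 'a \<Rightarrow> real) \<Rightarrow> bool" where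
  "finitely_injective M d \<longleftrightarrow>
     (\<forall>(L::nat set) dL K f.
        Metric_space L dL \<and> finite L \<and> K \<subseteq> L \<and> isometric_embedding K dL M d f \<longrightarrow>
        (\<exists>g. isometric_embedding L dL M d g \<and> (\<forall>x\<in>K. g x = f x)))"

definition urysohn_space :: "'a set \<Rightarrow> ('a \<Rightarrow> 'a \<Rightarrow> real) \<Rightarrow> bool" where
  "urysohn_space M d \<longleftrightarrow>
     Metric_space M d \<and>
     Metric_space.mcomplete M d \<and>
     separable_space (Metric_space.mtopology M d) \<and>
     \<not> Metric_space.mbounded M d M \<and>
     finitely_injective M d"

definition isometry_group :: "'a set \<Rightarrow> ('a \<Rightarrow> 'a \<Rightarrow> real) \<Rightarrow> ('a \<Rightarrow> 'a) monoid" where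
  "isometry_group M d =
     BijGroup M \<lparr>carrier := {g \<in> Bij M. \<forall>x\<in>M. \<forall>y\<in>M. d (g x) (g y) = d x y}\<rparr>"

text \<open>The topology of pointwise convergence is induced by the product topology on the
  (extensional) functions from the space to itself.\<close>

definition isometry_group_topology ::
    "'a set \<Rightarrow> ('a \<Rightarrow> 'a \<Rightarrow> real) \<Rightarrow> ('a \<Rightarrow> 'a) topology" where
  "isometry_group_topology M d =
     subtopology (product_topology (\<lambda>_. Metric_space.mtopology M d) M)
                 (carrier (isometry_group M d))"


section \<open>Topological groups, actions and equivariant compactifications\<close>

definition topological_group :: "('g, 'm) monoid_scheme \<Rightarrow> 'g topology \<Rightarrow> bool" where
  "topological_group G T \<longleftrightarrow>
     group G \<and> topspace T = carrier G \<and>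
     continuous_map (prod_topology T T) T (\<lambda>(g, h). g \<otimes>\<^bsub>G\<^esub> h) \<and>
     continuous_map T T (\<lambda>g. inv\<^bsub>G\<^esub> g)"

definition G_space ::
    "('g, 'm) monoid_scheme \<Rightarrow> 'g topology \<Rightarrow> 'x topology \<Rightarrow> ('g \<Rightarrow> 'x \<Rightarrow> 'x) \<Rightarrow> bool" where
  "G_space G T X \<phi> \<longleftrightarrow>
     topological_group G T \<and>
     completely_regular_space X \<and> Hausdorff_space X \<and>
     group_action G (topspace X) \<phi> \<and>
     continuous_map (prod_topology T X) X (\<lambda>(g, x). \<phi> g x)"

definition equivariant_compactification ::
    "('g, 'm) monoid_scheme \<Rightarrow> 'g topology \<Rightarrow> 'x topology \<Rightarrow> ('g \<Rightarrow> 'x \<Rightarrow> 'x) \<Rightarrow>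
     'k topology \<Rightarrow> ('g \<Rightarrow> 'k \<Rightarrow> 'k) \<Rightarrow> ('x \<Rightarrow> 'k) \<Rightarrow> bool" where
  "equivariant_compactification G T X \<phi> K \<psi> \<nu> \<longleftrightarrow>
     G_space G T X \<phi> \<and>
     G_space G T K \<psi> \<and> compact_space K \<and> Hausdorff_space K \<and>
     continuous_map X K \<nu> \<and>
     (\<forall>g\<in>carrier G. \<forall>x\<in>topspace X. \<nu> (\<phi> g x) = \<psi> g (\<nu> x)) \<and>
     K closure_of (\<nu> ` topspace X) = topspace K"

definition compactification_factor ::
    "'x topology \<Rightarrow> 'l topology \<Rightarrow> ('x \<Rightarrow> 'l) \<Rightarrow> 'k topology \<Rightarrow> ('x \<Rightarrow> 'k) \<Rightarrow> bool" where
  "compactification_factor X K' \<nu>' K \<nu> \<longleftrightarrow>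
     (\<exists>\<pi>. continuous_map K K' \<pi> \<and> (\<forall>x\<in>topspace X. \<pi> (\<nu> x) = \<nu>' x))"

definition equivalent_compactifications ::
    "'x topology \<Rightarrow> 'l topology \<Rightarrow> ('x \<Rightarrow> 'l) \<Rightarrow> 'k topology \<Rightarrow> ('x \<Rightarrow> 'k) \<Rightarrow> bool" where
  "equivalent_compactifications X K' \<nu>' K \<nu> \<longleftrightarrow>
     compactification_factor X K' \<nu>' K \<nu> \<and> compactification_factor X K \<nu> K' \<nu>'"

text \<open>A formula of HOL cannot quantify over all types, so the type of points of the competing
  compactifications is a parameter.  A theorem in which it is a type variable speaks about all
  equivariant compactifications.\<close>

definition greatest_equivariant_compactification ::
    "'l itself \<Rightarrow> ('g, 'm) monoid_scheme \<Rightarrow> 'g topology \<Rightarrow> 'x topology \<Rightarrow> ('g \<Rightarrow> 'x \<Rightarrow> 'x) \<Rightarrow>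
     'k topology \<Rightarrow> ('g \<Rightarrow> 'k \<Rightarrow> 'k) \<Rightarrow> ('x \<Rightarrow> 'k) \<Rightarrow> bool" where
  "greatest_equivariant_compactification (_::'l itself) G T X \<phi> K \<psi> \<nu> \<longleftrightarrow>
     equivariant_compactification G T X \<phi> K \<psi> \<nu> \<and>
     (\<forall>(K'::'l topology) \<psi>' \<nu>'.
        equivariant_compactification G T X \<phi> K' \<psi>' \<nu>' \<longrightarrow>
        compactification_factor X K' \<nu>' K \<nu>)"


section \<open>The Samuel and Gromov compactifications\<close>

text \<open>A uniformity on a set \<open>S\<close> is given as its filter of entourages, a filter on pairs that
  contains \<open>S \<times> S\<close>.  Functions on \<open>S\<close> are taken extensional.\<close>

definition samuel_algebra :: "'a set \<Rightarrow> ('a \<times> 'a) filter \<Rightarrow> ('a \<Rightarrow> real) set" where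
  "samuel_algebra S \<U> =
     {f \<in> extensional S. bounded (f ` S) \<and> (LIM (x, y) \<U>. (f x, f y) :> uniformity)}"

definition samuel_map :: "'a set \<Rightarrow> ('a \<times> 'a) filter \<Rightarrow> 'a \<Rightarrow> ('a \<Rightarrow> real) \<Rightarrow> real" where
  "samuel_map S \<U> x = (\<lambda>f\<in>samuel_algebra S \<U>. f x)"

text \<open>The compactification corresponding to a closed unital algebra of bounded functions is
  realised as the closure of the image of the evaluation map in the power of the real line
  indexed by the algebra.\<close>

definition samuel_compactification ::
    "'a set \<Rightarrow> ('a \<times> 'a) filter \<Rightarrow> (('a \<Rightarrow> real) \<Rightarrow> real) topology" where
  "samuel_compactification S \<U> =
     (let P = product_topology (\<lambda>_. euclideanreal) (samuel_algebra S \<U>)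
      in subtopology P (P closure_of (samuel_map S \<U> ` S)))"

text \<open>The initial uniformity generated by the functions \<open>\<lambda>x. d x z\<close> for \<open>z \<in> M\<close>.\<close>

definition weak_uniformity :: "'a set \<Rightarrow> ('a \<Rightarrow> 'a \<Rightarrow> real) \<Rightarrow> ('a \<times> 'a) filter" where
  "weak_uniformity M d =
     inf (INF z\<in>M. filtercomap (\<lambda>(x, y). (d x z, d y z)) uniformity) (principal (M \<times> M))"

definition gromov_compactification ::
    "'a set \<Rightarrow> ('a \<Rightarrow> 'a \<Rightarrow> real) \<Rightarrow> (('a \<Rightarrow> real) \<Rightarrow> real) topology" where
  "gromov_compactification M d = samuel_compactification M (weak_uniformity M d)"

definition gromov_map :: "'a set \<Rightarrow> ('a \<Rightarrow> 'a \<Rightarrow> real) \<Rightarrow> 'a \<Rightarrow> ('a \<Rightarrow> real) \<Rightarrow> real" where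
  "gromov_map M d = samuel_map M (weak_uniformity M d)"

end

theory Submission
  imports Defs
begin

text \<open>
  A function on \<open>M\<close> that extends to an equivariant compactification is right uniformly continuous:
  it moves by less than \<open>\<epsilon>\<close> under every isometry that displaces a certain finite set \<open>A\<close> by less than
  \<open>\<delta>\<close>.  If the distances from \<open>x\<close> and \<open>y\<close> to the points of \<open>A\<close> differ by at most \<open>\<delta> / 2\<close>, then by
  amalgamation and ultrahomogeneity some isometry sends \<open>x\<close> to \<open>y\<close> and moves each point of \<open>A\<close> by
  at most \<open>\<delta> / 2\<close>.  So the function is uniformly continuous for the weak uniformity, that is, it
  belongs to the Gromov algebra.  Conversely, \<open>\<bar>d (g x) z - d (h x) z\<bar>\<close> is bounded, uniformly in \<open>x\<close>,
  by a pointwise distance between \<open>g\<close> and \<open>h\<close>; hence orbits in the Gromov algebra are norm continuous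
  and the action on the Gromov compactification is jointly continuous.

  For the failure of metrizability, take a sequence whose distances to a base point have gaps at
  least 1.  A bounded Lipschitz function of the distance separates the even from the odd terms
  of any given subsequence, so no subsequence converges.
\<close>

section \<open>Ultrahomogeneity\<close>

context Metric_space
begin

section \<open>Realising finite distance data by points of the space\<close>

text \<open>The two inequalities say that \<open>h\<close> is a Katetov function on
  \<open>A\<close>, that is, a possible distance function of one new point. Finite injectivity
  speaks of sets of numbers only, so \<open>A\<close> is copied to the indices below
  \<open>n\<close> and the index \<open>n\<close> becomes the new point.\<close>

lemma one_point_extension:
  assumes inj: "finitely_injective M d" and A: "finite A" "A \<subseteq> M"
    and lower: "\<And>a b. \<lbrakk>a \<in> A; b \<in> A\<rbrakk> \<Longrightarrow> h a \<le> d a b + h b"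
    and upper: "\<And>a b. \<lbrakk>a \<in> A; b \<in> A\<rbrakk> \<Longrightarrow> d a b \<le> h a + h b"
  shows "\<exists>p\<in>M. \<forall>a\<in>A. d p a = h a"
\<comment> \<open>If \<open>h a = 0\<close>, the new point would coincide with \<open>a\<close> and
  the extended space would not be a metric space; but then the inequalities force \<open>h\<close>
  to be the distance to \<open>a\<close>, so \<open>a\<close> itself serves.\<close>
proof (cases "\<exists>a\<in>A. h a = 0")
  case True
  then obtain a where a: "a \<in> A" "h a = 0" by blast
  have "d a b = h b" if "b \<in> A" for b
    using lower[OF that a(1)] upper[OF a(1) that] a commute by (simp add: commute)
  then show ?thesis using a A by blast
next
  case False
  have nn: "h a > 0" if "a \<in> A" for a
    using upper[OF that that] A that False by (force simp: less_le)
  obtain q and n :: nat where q: "bij_betw q {..<n} A"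
    using ex_bij_betw_nat_finite[OF A(1)] atLeast0LessThan by metis
  have qA: "q i \<in> A" if "i < n" for i using q that bij_betwE by blast
  have qM: "q i \<in> M" if "i < n" for i using qA that A by blast
  have qinj: "q i = q j \<longleftrightarrow> i = j" if "i < n" "j < n" for i j
    using q that unfolding bij_betw_def by (auto simp: inj_on_def)
  \<comment> \<open>Every index from \<open>n\<close> on is treated like the new point. The values
    beyond \<open>n\<close> matter because \<open>Metric_space\<close> demands nonnegativity and
    symmetry of all arguments, not only of those in the carrier.\<close>
  define dL where "dL i j = (if i = j then 0 else if i < n \<and> j < n then d (q i) (q j)
      else if i < n then h (q i) else if j < n then h (q j) else 0)" for i j
  have L: "Metric_space {..n} dL"
  proof
    fix x y
    show "0 \<le> dL x y" using nn qA by (auto simp: dL_def less_imp_le)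
    show "dL x y = dL y x" by (auto simp: dL_def commute)
  next
    fix x y assume "x \<in> {..n}" "y \<in> {..n}"
    then show "dL x y = 0 \<longleftrightarrow> x = y"
      using nn[OF qA, of x] nn[OF qA, of y] qinj qM by (auto simp: dL_def)
  next
    fix x y z assume "x \<in> {..n}" "y \<in> {..n}" "z \<in> {..n}"
    then have *: "x < n \<or> x = n" "y < n \<or> y = n" "z < n \<or> z = n" by auto
    have lo: "h (q i) \<le> d (q i) (q j) + h (q j)" if "i < n" "j < n" for i j
      using lower qA that by blast
    have up: "d (q i) (q j) \<le> h (q i) + h (q j)" if "i < n" "j < n" for i j
      using upper qA that by blast
    have pos: "h (q i) > 0" if "i < n" for i using nn qA that by blast
    have tri: "d (q i) (q k) \<le> d (q i) (q j) + d (q j) (q k)" if "i < n" "j < n" "k < n" for i j k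
      using triangle qM that by blast
    have com: "d (q i) (q j) = d (q j) (q i)" for i j by (rule commute)
    have self: "d (q i) (q i) = 0" if "i < n" for i using qM that by simp
    have DL: "dL i j = d (q i) (q j)" "dL i n = h (q i)" "dL n i = h (q i)" "dL n n = 0"
      if "i < n" "j < n" for i j
      using that self by (auto simp: dL_def)
    show "dL x z \<le> dL x y + dL y z"
    proof (cases "x < n"; cases "y < n"; cases "z < n")
      assume "x < n" "y < n" "z < n" then show ?thesis using tri by (simp add: DL)
    next
      assume "x < n" "y < n" "\<not> z < n" then show ?thesis using * lo by (simp add: DL)
    next
      assume "x < n" "\<not> y < n" "z < n" then show ?thesis using * up by (simp add: DL)
    next
      assume "x < n" "\<not> y < n" "\<not> z < n" then show ?thesis using * by (simp add: DL dL_def)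
    next
      assume "\<not> x < n" "y < n" "z < n" then show ?thesis using * lo[of z y] com[of z y] by (simp add: DL)
    next
      assume "\<not> x < n" "y < n" "\<not> z < n" then show ?thesis using * pos[of y] by (simp add: DL dL_def)
    next
      assume "\<not> x < n" "\<not> y < n" "z < n" then show ?thesis using * by (simp add: DL dL_def)
    next
      assume "\<not> x < n" "\<not> y < n" "\<not> z < n" then show ?thesis using * by (simp add: dL_def)
    qed
  qed
  have "isometric_embedding {..<n} dL M d q"
    using qM by (auto simp: isometric_embedding_def dL_def)
  then obtain g where g: "isometric_embedding {..n} dL M d g" "\<And>i. i < n \<Longrightarrow> g i = q i"
    using inj L unfolding finitely_injective_def
    by (metis finite_atMost lessThan_iff lessThan_subset_iff ivl_disj_un_singleton(2) Un_upper1)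
  have "d (g n) a = h a" if "a \<in> A" for a
  proof -
    have "a \<in> q ` {..<n}" using q that by (simp add: bij_betw_def)
    then obtain i where i: "i < n" "a = q i" by blast
    have "d (g n) (g i) = dL n i" using g(1) i by (auto simp: isometric_embedding_def)
    then show ?thesis using i g(2) by (simp add: dL_def)
  qed
  moreover have "g n \<in> M" using g(1) by (auto simp: isometric_embedding_def)
  ultimately show ?thesis by blast
qed

text \<open>The points of \<open>I - J\<close> are added one after the other. Indices with a
  pseudometric are used instead of a metric space, so that distinct indices may land on the same
  point and applications need not check that distances are positive.\<close>

lemma pseudometric_extension:
  assumes inj: "finitely_injective M d" and I: "finite I"
    and refl: "\<And>i. i \<in> I \<Longrightarrow> \<rho> i i = 0"
    and sym: "\<And>i j. \<lbrakk>i \<in> I; j \<in> I\<rbrakk> \<Longrightarrow> \<rho> i j = \<rho> j i"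
    and tri: "\<And>i j k. \<lbrakk>i \<in> I; j \<in> I; k \<in> I\<rbrakk> \<Longrightarrow> \<rho> i k \<le> \<rho> i j + \<rho> j k"
    and J: "J \<subseteq> I" and f: "\<And>i. i \<in> J \<Longrightarrow> f i \<in> M"
    and iso: "\<And>i j. \<lbrakk>i \<in> J; j \<in> J\<rbrakk> \<Longrightarrow> d (f i) (f j) = \<rho> i j"
  shows "\<exists>g. (\<forall>i\<in>I. g i \<in> M) \<and> (\<forall>i\<in>I. \<forall>j\<in>I. d (g i) (g j) = \<rho> i j) \<and> (\<forall>i\<in>J. g i = f i)"
proof -
  have "finite S \<Longrightarrow> S \<subseteq> I \<Longrightarrow> \<exists>g. (\<forall>i\<in>J \<union> S. g i \<in> M) \<and>
      (\<forall>i\<in>J \<union> S. \<forall>j\<in>J \<union> S. d (g i) (g j) = \<rho> i j) \<and> (\<forall>i\<in>J. g i = f i)" for S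
  proof (induction rule: finite_induct)
    case empty
    then show ?case using f iso by auto
  next
    case (insert s S)
    then obtain g where g: "\<And>i. i \<in> J \<union> S \<Longrightarrow> g i \<in> M"
      "\<And>i j. \<lbrakk>i \<in> J \<union> S; j \<in> J \<union> S\<rbrakk> \<Longrightarrow> d (g i) (g j) = \<rho> i j" "\<And>i. i \<in> J \<Longrightarrow> g i = f i"
      by (metis insert_subset)
    show ?case
    proof (cases "s \<in> J \<union> S")
      case True
      then have "J \<union> insert s S = J \<union> S" by blast
      then show ?thesis using g by metis
    next
      case False
      have sub: "J \<union> S \<subseteq> I" "s \<in> I" using insert J by auto
      then have fin: "finite (J \<union> S)" using I finite_subset by blast
      \<comment> \<open>A Katetov function must be defined on points, while \<rho> is defined on
        indices; \<open>c\<close> chooses an index for each point. By \<open>ch\<close> the choice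
        is immaterial, because indices with the same image are at \<rho>-distance 0.\<close>
      define c where "c a = (SOME i. i \<in> J \<union> S \<and> g i = a)" for a
      have c: "c (g i) \<in> J \<union> S \<and> g (c (g i)) = g i" if "i \<in> J \<union> S" for i
        unfolding c_def by (rule someI[of _ i]) (use that in auto)
      have ch: "\<rho> s (c (g i)) = \<rho> s i" if "i \<in> J \<union> S" for i
      proof -
        have z: "\<rho> i (c (g i)) = 0" using g(2)[OF that, of "c (g i)"] c[OF that] g(1)[OF that] by simp
        have "c (g i) \<in> I" "i \<in> I" using c[OF that] that sub by auto
        then show ?thesis
          using z tri[of s i "c (g i)"] tri[of s "c (g i)" i] sym[of i "c (g i)"] sub by auto
      qed
      have "\<exists>p\<in>M. \<forall>a\<in>g ` (J \<union> S). d p a = \<rho> s (c a)"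
      proof (rule one_point_extension[OF inj])
        show "finite (g ` (J \<union> S))" using fin by blast
        show "g ` (J \<union> S) \<subseteq> M" using g by auto
        fix a b assume "a \<in> g ` (J \<union> S)" "b \<in> g ` (J \<union> S)"
        then obtain i j where ij: "i \<in> J \<union> S" "a = g i" "j \<in> J \<union> S" "b = g j" by blast
        have I': "i \<in> I" "j \<in> I" using ij sub by auto
        show "\<rho> s (c a) \<le> d a b + \<rho> s (c b)" "d a b \<le> \<rho> s (c a) + \<rho> s (c b)"
          unfolding ij ch[OF ij(1)] ch[OF ij(3)] g(2)[OF ij(1,3)]
          using tri[of s j i] tri[of i s j] sym[of s j] sym[of i j] sym[of s i] I' sub by auto
      qed
      then obtain p where p: "p \<in> M" "\<And>i. i \<in> J \<union> S \<Longrightarrow> d p (g i) = \<rho> s i" using ch by auto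
      have "d (g i) p = \<rho> i s" if "i \<in> J \<union> S" for i
        using p(2)[OF that] commute sym[of s i] that sub by auto
      then show ?thesis
        using p g False refl sub sym by (intro exI[of _ "g(s := p)"]) auto
    qed
  qed
  from this[of "I - J"] J I show ?thesis by (simp add: Un_absorb1)
qed

section \<open>Partial isometries and back-and-forth\<close>

text \<open>A relation rather than a function, so that inverting is taking the converse and the back
  step is the forth step for the converse. Single-valuedness and injectivity come for free, since
  distance 0 means equality.\<close>

definition partial_isometry :: "('a \<times> 'a) set \<Rightarrow> bool" where
  "partial_isometry R \<longleftrightarrow> R \<subseteq> M \<times> M \<and> (\<forall>(a, b)\<in>R. \<forall>(a', b')\<in>R. d a a' = d b b')"

lemma partial_isometry_converse: "partial_isometry R \<Longrightarrow> partial_isometry (R\<inverse>)"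
  unfolding partial_isometry_def by fastforce

lemma partial_isometry_forth:
  assumes inj: "finitely_injective M d" and R: "finite R" "partial_isometry R" and x: "x \<in> M"
  shows "\<exists>y. partial_isometry (insert (x, y) R)"
proof -
  have RM: "a \<in> M" "b \<in> M" if "(a, b) \<in> R" for a b
    using R(2) that unfolding partial_isometry_def by auto
  have iso: "d a a' = d b b'" if "(a, b) \<in> R" "(a', b') \<in> R" for a b a' b'
    using R(2) that unfolding partial_isometry_def by fastforce
  \<comment> \<open>The index \<open>(a, b)\<close> stands for the point \<open>a\<close> with
    prescribed image \<open>b\<close>, and \<open>(x, x)\<close> for the new point \<open>x\<close>.
    If \<open>x\<close> already lies in the domain, two indices are at distance 0, which a
    pseudometric permits.\<close>
  have "\<exists>g. (\<forall>i\<in>insert (x, x) R. g i \<in> M) \<and>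
      (\<forall>i\<in>insert (x, x) R. \<forall>j\<in>insert (x, x) R. d (g i) (g j) = d (fst i) (fst j)) \<and>
      (\<forall>i\<in>R. g i = snd i)"
  proof (rule pseudometric_extension[OF inj])
    fix i j k assume "i \<in> insert (x, x) R" "j \<in> insert (x, x) R" "k \<in> insert (x, x) R"
    then have "fst i \<in> M" "fst j \<in> M" "fst k \<in> M" using R(2) x unfolding partial_isometry_def by auto
    then show "d (fst i) (fst k) \<le> d (fst i) (fst j) + d (fst j) (fst k)" by (rule triangle)
  next
    fix i j assume "i \<in> R" "j \<in> R"
    then show "d (snd i) (snd j) = d (fst i) (fst j)" using iso by (metis prod.collapse)
  qed (use R(1) RM x commute in auto)
  then obtain g where g: "\<And>i. i \<in> insert (x, x) R \<Longrightarrow> g i \<in> M"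
    "\<And>i j. \<lbrakk>i \<in> insert (x, x) R; j \<in> insert (x, x) R\<rbrakk> \<Longrightarrow> d (g i) (g j) = d (fst i) (fst j)"
    "\<And>i. i \<in> R \<Longrightarrow> g i = snd i"
    by blast
  have "d (g (x, x)) b = d x a" "d b (g (x, x)) = d a x" if "(a, b) \<in> R" for a b
    using g(2)[of "(x, x)" "(a, b)"] g(2)[of "(a, b)" "(x, x)"] g(3)[OF that] that by auto
  then have "partial_isometry (insert (x, g (x, x)) R)"
    using g(1)[of "(x, x)"] x R(2) unfolding partial_isometry_def by auto
  then show ?thesis ..
qed

lemma partial_isometryI:
  assumes "R \<subseteq> M \<times> M"
    and "\<And>a b a' b'. \<lbrakk>(a, b) \<in> R; (a', b') \<in> R\<rbrakk> \<Longrightarrow> d a a' = d b b'"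
  shows "partial_isometry R"
  unfolding partial_isometry_def using assms by blast

lemma partial_isometryD:
  assumes "partial_isometry R" "(a, b) \<in> R"
  shows "a \<in> M" "b \<in> M" "(a', b') \<in> R \<Longrightarrow> d a a' = d b b'"
  using assms unfolding partial_isometry_def by blast+

lemma partial_isometry_back:
  assumes "finitely_injective M d" "finite R" "partial_isometry R" "y \<in> M"
  shows "\<exists>x. partial_isometry (insert (x, y) R)"
proof -
  obtain x where "partial_isometry (insert (y, x) (R\<inverse>))"
    using partial_isometry_forth[of "R\<inverse>" y] partial_isometry_converse assms by auto
  then have "partial_isometry ((insert (y, x) (R\<inverse>))\<inverse>)" by (rule partial_isometry_converse)
  moreover have "(insert (y, x) (R\<inverse>))\<inverse> = insert (x, y) R" by auto
  ultimately show ?thesis by metis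
qed

text \<open>Back and forth along the sequence \<open>e\<close>: stage \<open>n\<close> puts
  \<open>e n\<close> first into the domain and then into the range. The union of the stages is again
  a partial isometry, as any two of its pairs occur at a common stage.\<close>

lemma partial_isometry_dense_extension:
  assumes inj: "finitely_injective M d" and R: "finite R" "partial_isometry R"
    and e: "\<And>n::nat. e n \<in> M"
  shows "\<exists>S. R \<subseteq> S \<and> partial_isometry S \<and> range e \<subseteq> Domain S \<and> range e \<subseteq> Range S"
proof -
  have "\<exists>T. \<forall>n. (finite (T n) \<and> partial_isometry (T n) \<and> R \<subseteq> T n) \<and>
      T n \<subseteq> T (Suc n) \<and> e n \<in> Domain (T (Suc n)) \<and> e n \<in> Range (T (Suc n))"
  proof (rule dependent_nat_choice[where P = "\<lambda>n T. finite T \<and> partial_isometry T \<and> R \<subseteq> T"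
        and Q = "\<lambda>n T T'. T \<subseteq> T' \<and> e n \<in> Domain T' \<and> e n \<in> Range T'"])
    show "\<exists>T. finite T \<and> partial_isometry T \<and> R \<subseteq> T" using R by blast
    fix T n assume T: "finite T \<and> partial_isometry T \<and> R \<subseteq> T"
    obtain y where y: "partial_isometry (insert (e n, y) T)"
      using partial_isometry_forth[OF inj] T e by blast
    obtain x where x: "partial_isometry (insert (x, e n) (insert (e n, y) T))"
      using partial_isometry_back[OF inj _ y] T e by blast
    show "\<exists>T'. (finite T' \<and> partial_isometry T' \<and> R \<subseteq> T') \<and>
        T \<subseteq> T' \<and> e n \<in> Domain T' \<and> e n \<in> Range T'"
      using T x by (intro exI[of _ "insert (x, e n) (insert (e n, y) T)"]) auto
  qed
  then obtain T where T: "\<And>n. partial_isometry (T n)" "\<And>n. R \<subseteq> T n" "\<And>n. T n \<subseteq> T (Suc n)"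
    "\<And>n. e n \<in> Domain (T (Suc n))" "\<And>n. e n \<in> Range (T (Suc n))"
    by metis
  have mono: "T m \<subseteq> T n" if "m \<le> n" for m n
    by (rule lift_Suc_mono_le[of T]) (use T(3) that in auto)
  have "partial_isometry (\<Union>n. T n)"
  proof -
    have "d a a' = d b b'" if *: "(a, b) \<in> (\<Union>n. T n)" "(a', b') \<in> (\<Union>n. T n)" for a b a' b'
    proof -
      obtain m n where "(a, b) \<in> T m" "(a', b') \<in> T n" using * by blast
      then have "(a, b) \<in> T (max m n)" "(a', b') \<in> T (max m n)"
        using mono[of m "max m n"] mono[of n "max m n"] by auto
      then show ?thesis
        using partial_isometryD(3)[OF T(1)[of "max m n"]] by blast
    qed
    moreover have "(\<Union>n. T n) \<subseteq> M \<times> M" using T(1) unfolding partial_isometry_def by blast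
    ultimately show ?thesis using partial_isometryI by blast
  qed
  moreover have "range e \<subseteq> Domain (\<Union>n. T n)" "range e \<subseteq> Range (\<Union>n. T n)"
    using T(4,5) by blast+
  moreover have "R \<subseteq> (\<Union>n. T n)" using T(2) by blast
  ultimately show ?thesis by blast
qed

section \<open>Passing to the closure of a graph\<close>

text \<open>This is the closure of \<open>S\<close> in the product space. Closing the graph takes
  the place of extending a uniformly continuous map and treats domain and range
  symmetrically.\<close>

definition metric_closure_rel :: "('a \<times> 'a) set \<Rightarrow> ('a \<times> 'a) set" where
  "metric_closure_rel S =
     {(x, y) \<in> M \<times> M. \<forall>\<epsilon>>0. \<exists>(a, b)\<in>S. d x a < \<epsilon> \<and> d y b < \<epsilon>}"

lemma metric_closure_rel_converse: "metric_closure_rel (S\<inverse>) = (metric_closure_rel S)\<inverse>"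
proof -
  have "(\<exists>(a, b)\<in>S\<inverse>. d x a < \<epsilon> \<and> d y b < \<epsilon>) \<longleftrightarrow> (\<exists>(a, b)\<in>S. d y a < \<epsilon> \<and> d x b < \<epsilon>)" for x y \<epsilon>
    by blast
  then show ?thesis unfolding metric_closure_rel_def by auto
qed

lemma metric_closure_relE:
  assumes "(x, y) \<in> metric_closure_rel S" "\<epsilon> > 0"
  obtains a b where "(a, b) \<in> S" "d x a < \<epsilon>" "d y b < \<epsilon>"
  using assms unfolding metric_closure_rel_def by blast

lemma partial_isometry_closure:
  assumes S: "partial_isometry S"
  shows "partial_isometry (metric_closure_rel S)"
proof -
  have "d x x' = d y y'"
    if *: "(x, y) \<in> metric_closure_rel S" "(x', y') \<in> metric_closure_rel S" for x y x' y'
  proof (rule ccontr)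
    have M: "x \<in> M" "y \<in> M" "x' \<in> M" "y' \<in> M" using that by (auto simp: metric_closure_rel_def)
    assume neq: "d x x' \<noteq> d y y'"
    \<comment> \<open>A quarter of the supposed defect: four approximation errors, each below
      \<epsilon>, cannot add up to it.\<close>
    define \<epsilon> where "\<epsilon> = \<bar>d x x' - d y y'\<bar> / 4"
    have \<epsilon>: "\<epsilon> > 0" using neq by (simp add: \<epsilon>_def)
    obtain a b where ab: "(a, b) \<in> S" "d x a < \<epsilon>" "d y b < \<epsilon>"
      by (rule metric_closure_relE[OF *(1) \<epsilon>])
    obtain a' b' where ab': "(a', b') \<in> S" "d x' a' < \<epsilon>" "d y' b' < \<epsilon>"
      by (rule metric_closure_relE[OF *(2) \<epsilon>])
    have ABM: "a \<in> M" "b \<in> M" "a' \<in> M" "b' \<in> M" and eq: "d a a' = d b b'"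
      using partial_isometryD[OF S ab(1)] partial_isometryD[OF S ab'(1)] ab'(1) by auto
    have "\<bar>d x x' - d a a'\<bar> \<le> d x a + d x' a'" "\<bar>d y y' - d b b'\<bar> \<le> d y b + d y' b'"
      using M ABM triangle[of x a x'] triangle[of a a' x'] triangle[of a x a'] triangle[of x x' a']
        triangle[of y b y'] triangle[of b b' y'] triangle[of b y b'] triangle[of y y' b']
      by (auto simp: commute)
    then have "\<bar>d x x' - d y y'\<bar> \<le> d x a + d x' a' + (d y b + d y' b')" using eq by linarith
    moreover have "\<bar>d x x' - d y y'\<bar> = 4 * \<epsilon>" by (simp add: \<epsilon>_def)
    ultimately show False using ab ab' by linarith
  qed
  moreover have "metric_closure_rel S \<subseteq> M \<times> M" unfolding metric_closure_rel_def by blast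
  ultimately show ?thesis using partial_isometryI by blast
qed

text \<open>Choose pairs of \<open>S\<close> whose first components converge to \<open>x\<close>.
  These components form a Cauchy sequence, and \<open>S\<close> preserves distances, so the second
  components do too; by completeness they have a limit, which is the desired
  \<open>y\<close>.\<close>

lemma metric_closure_rel_total:
  assumes complete: "mcomplete" and S: "partial_isometry S"
    and dense: "M \<subseteq> mtopology closure_of (Domain S)" and x: "x \<in> M"
  shows "\<exists>y. (x, y) \<in> metric_closure_rel S"
proof -
  have "\<exists>p. p \<in> S \<and> d x (fst p) < 1 / Suc n" for n
  proof -
    have "x \<in> mtopology closure_of (Domain S)" using dense x by blast
    moreover have "1 / real (Suc n) > 0" by simp
    ultimately obtain a where "a \<in> Domain S" "d x a < 1 / Suc n"
      unfolding metric_closure_of in_mball by blast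
    then show ?thesis by auto
  qed
  then obtain p where p: "\<And>n. p n \<in> S" "\<And>n. d x (fst (p n)) < 1 / Suc n" by metis
  have pM: "fst (p n) \<in> M" "snd (p n) \<in> M" for n
    using p(1)[of n] S unfolding partial_isometry_def by auto
  have piso: "d (fst (p m)) (fst (p n)) = d (snd (p m)) (snd (p n))" for m n
    using p(1)[of n] p(1)[of m] S unfolding partial_isometry_def by (auto simp: case_prod_beta)
  have small: "\<exists>N. \<forall>n\<ge>N. 1 / Suc n < \<epsilon>" if "\<epsilon> > 0" for \<epsilon> :: real
    using order_tendstoD(2)[OF LIMSEQ_inverse_real_of_nat that]
    by (simp add: eventually_sequentially inverse_eq_divide)
  have "MCauchy (\<lambda>n. snd (p n))"
    unfolding MCauchy_def
  proof (intro conjI allI impI)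
    show "range (\<lambda>n. snd (p n)) \<subseteq> M" using pM by blast
    fix \<epsilon> :: real assume "\<epsilon> > 0"
    then obtain N where N: "\<And>n. n \<ge> N \<Longrightarrow> 1 / Suc n < \<epsilon> / 2" using small[of "\<epsilon> / 2"] by auto
    have "d (snd (p n)) (snd (p n')) < \<epsilon>" if "N \<le> n" "N \<le> n'" for n n'
      using piso[of n n'] triangle[of "fst (p n)" x "fst (p n')"] x pM commute[of x "fst (p n)"]
        p(2)[of n] p(2)[of n'] N[OF that(1)] N[OF that(2)] by simp
    then show "\<exists>N. \<forall>n n'. N \<le> n \<longrightarrow> N \<le> n' \<longrightarrow> d (snd (p n)) (snd (p n')) < \<epsilon>" by blast
  qed
  then obtain y where y: "limitin mtopology (\<lambda>n. snd (p n)) y sequentially"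
    using complete unfolding mcomplete_def by blast
  have "\<exists>(a, b)\<in>S. d x a < \<epsilon> \<and> d y b < \<epsilon>" if \<epsilon>: "\<epsilon> > 0" for \<epsilon>
  proof -
    obtain N where N: "\<And>n. n \<ge> N \<Longrightarrow> 1 / Suc n < \<epsilon>" using small[OF \<epsilon>] by auto
    obtain K where K: "\<And>n. n \<ge> K \<Longrightarrow> d (snd (p n)) y < \<epsilon>"
      using y \<epsilon> unfolding limit_metric_sequentially by blast
    have "d x (fst (p (max N K))) < \<epsilon>" "d y (snd (p (max N K))) < \<epsilon>"
      using p(2)[of "max N K"] N[of "max N K"] K[of "max N K"] commute by auto
    then show ?thesis using p(1)[of "max N K"] by (intro bexI[of _ "p (max N K)"]) (auto simp: case_prod_beta)
  qed
  moreover have "y \<in> M" using y limitin_mspace by blast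
  ultimately show ?thesis using x unfolding metric_closure_rel_def by auto
qed

text \<open>Back-and-forth over a countable dense set extends \<open>R\<close> to a partial isometry
  with dense domain and dense range. Its closure is then total in both directions by completeness,
  hence the graph of an isometry of \<open>M\<close> onto itself.\<close>

theorem ultrahomogeneous:
  assumes inj: "finitely_injective M d" and complete: "mcomplete"
    and sep: "separable_space mtopology"
    and R: "finite R" "partial_isometry R"
  shows "\<exists>g\<in>carrier (isometry_group M d). \<forall>(a, b)\<in>R. g a = b"
proof -
  obtain D where D: "countable D" "D \<subseteq> M" "mtopology closure_of D = M"
    using sep unfolding separable_space_def by auto
  \<comment> \<open>The one-point extension of the empty set shows that \<open>M\<close> is
    nonempty. Hence so is \<open>D\<close>, which \<open>from_nat_into\<close> needs in order to
    enumerate it.\<close>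
  have "\<exists>p\<in>M. \<forall>a\<in>{}. d p a = 0" by (rule one_point_extension[OF inj]) auto
  then have "M \<noteq> {}" by blast
  then have "D \<noteq> {}" using D by (metis closure_of_empty)
  then have rng: "range (from_nat_into D) = D" using D by (simp add: range_from_nat_into)
  have "from_nat_into D n \<in> M" for n using rng D by blast
  then obtain S where S: "R \<subseteq> S" "partial_isometry S" "D \<subseteq> Domain S" "D \<subseteq> Range S"
    using partial_isometry_dense_extension[OF inj R, of "from_nat_into D"] unfolding rng by blast
  have dense: "M \<subseteq> mtopology closure_of (Domain S)" "M \<subseteq> mtopology closure_of (Range S)"
    using D(3) closure_of_mono S(3,4) by metis+
  define C where "C = metric_closure_rel S"
  have C: "partial_isometry C" unfolding C_def by (rule partial_isometry_closure[OF S(2)])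
  have CM: "a \<in> M" "b \<in> M" if "(a, b) \<in> C" for a b
    using partial_isometryD[OF C that] by auto
  have Ciso: "d a a' = d b b'" if "(a, b) \<in> C" "(a', b') \<in> C" for a b a' b'
    using partial_isometryD(3)[OF C that] .
  have total: "\<exists>y. (x, y) \<in> C" if "x \<in> M" for x
    unfolding C_def by (rule metric_closure_rel_total[OF complete S(2) dense(1) that])
  have onto: "\<exists>x. (x, y) \<in> C" if "y \<in> M" for y
    using metric_closure_rel_total[OF complete partial_isometry_converse[OF S(2)] _ that] dense(2)
    unfolding C_def metric_closure_rel_converse by auto
  have RC: "R \<subseteq> C"
  proof
    fix p assume "p \<in> R"
    then show "p \<in> C"
      using S(1,2) unfolding C_def metric_closure_rel_def partial_isometry_def
      by (cases p) (auto intro!: bexI[of _ p])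
  qed
  define g where "g = (\<lambda>x\<in>M. SOME y. (x, y) \<in> C)"
  have g: "(x, g x) \<in> C" if "x \<in> M" for x
    using someI_ex[OF total[OF that]] that by (simp add: g_def)
  have uniq: "g x = y" if "(x, y) \<in> C" for x y
    using Ciso[OF g[OF CM(1)[OF that]] that] CM[OF that] CM[OF g[OF CM(1)[OF that]]] by simp
  have giso: "d (g x) (g y) = d x y" if "x \<in> M" "y \<in> M" for x y
    using Ciso[OF g[OF that(1)] g[OF that(2)]] by simp
  have gM: "g x \<in> M" if "x \<in> M" for x using CM g that by blast
  have "bij_betw g M M"
    unfolding bij_betw_def
  proof
    show "inj_on g M" using giso gM by (metis inj_onI zero)
    show "g ` M = M" using gM onto uniq CM by (force simp: image_iff)
  qed
  then have "g \<in> carrier (isometry_group M d)"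
    using giso by (auto simp: isometry_group_def Bij_def g_def)
  then show ?thesis using uniq RC by blast
qed

text \<open>Two copies of \<open>M\<close> are glued: \<open>x\<close> in the second copy is identified with \<open>y\<close> in the first, and
  each \<open>a \<in> A\<close> is joined to its twin by a bridge of length \<open>\<delta>\<close>.  The finite injectivity of \<open>M\<close>
  realises the finite part of this space that is needed.\<close>

lemma almost_fixing_isometry:
  assumes inj: "finitely_injective M d" and complete: "mcomplete"
    and sep: "separable_space mtopology"
    and A: "finite A" "A \<subseteq> M" and xy: "x \<in> M" "y \<in> M"
    and close: "\<And>a. a \<in> A \<Longrightarrow> \<bar>d x a - d y a\<bar> \<le> \<delta>" and \<delta>: "\<delta> \<ge> 0"
  shows "\<exists>g\<in>carrier (isometry_group M d). g x = y \<and> (\<forall>a\<in>A. d (g a) a \<le> \<delta>)"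
proof -
  \<comment> \<open>\<open>C\<close> lists the bridges: a pair joins a point of the first copy to
    one of the second, and \<open>w\<close> is the length. \<open>m p q\<close> is the length of a
    shortest route from \<open>p\<close> in the first copy to \<open>q\<close> in the second that
    crosses exactly one bridge. In \<rho>, \<open>Inl\<close> marks the first copy and
    \<open>Inr\<close> the second.\<close>
  define C where "C = insert (y, x) ((\<lambda>a. (a, a)) ` A)"
  define w where "w c = (if c = (y, x) then 0 else \<delta>)" for c
  define m where "m p q = (MIN c\<in>C. d p (fst c) + w c + d (snd c) q)" for p q
  define \<rho> where "\<rho> i j = (case (i, j) of (Inl p, Inl q) \<Rightarrow> d p q | (Inl p, Inr q) \<Rightarrow> m p q
      | (Inr p, Inl q) \<Rightarrow> m q p | (Inr p, Inr q) \<Rightarrow> d p q)" for i j :: "'a + 'a"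
  define I where "I = Inl ` (insert y A) \<union> Inr ` (insert x A)"
  have C: "finite C" "C \<noteq> {}" using A by (auto simp: C_def)
  have CM: "fst c \<in> M" "snd c \<in> M" if "c \<in> C" for c using that A xy by (auto simp: C_def)
  have w: "w c \<ge> 0" for c using \<delta> by (simp add: w_def)
  \<comment> \<open>The only place where the hypothesis \<open>close\<close> enters: it treats the
    pairing of \<open>(y, x)\<close> with a bridge at a point of \<open>A\<close>. Two bridges over
    \<open>A\<close> have ends at equal distances in both copies.\<close>
  have bridge: "\<bar>d (fst c) (fst c') - d (snd c) (snd c')\<bar> \<le> w c + w c'" if "c \<in> C" "c' \<in> C" for c c'
  proof -
    have e: "\<bar>d a y - d a x\<bar> \<le> \<delta>" "\<bar>d y a - d x a\<bar> \<le> \<delta>" if "a \<in> A" for a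
      using close[OF that] commute[of a x] commute[of a y] by auto
    from that consider "c = (y, x)" "c' = (y, x)" | a where "c = (y, x)" "c' = (a, a)" "a \<in> A"
      | a where "c = (a, a)" "c' = (y, x)" "a \<in> A"
      | a b where "c = (a, a)" "c' = (b, b)" "a \<in> A" "b \<in> A"
      unfolding C_def by blast
    then show ?thesis
    proof cases
      case 1
      then show ?thesis using xy by (simp add: w_def)
    next
      case (2 a)
      then show ?thesis using e[of a] xy by (auto simp: w_def)
    next
      case (3 a)
      then show ?thesis using e[of a] xy by (auto simp: w_def)
    next
      case (4 a b)
      then show ?thesis using w[of c] w[of c'] by simp
    qed
  qed
  have m_le: "m p q \<le> d p (fst c) + w c + d (snd c) q" if "c \<in> C" for p q c
    unfolding m_def using that C by (auto intro!: Min_le)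
  have m_ex: "\<exists>c\<in>C. m p q = d p (fst c) + w c + d (snd c) q" for p q
  proof -
    have "m p q \<in> (\<lambda>c. d p (fst c) + w c + d (snd c) q) ` C"
      unfolding m_def using C by (intro Min_in) auto
    then show ?thesis by blast
  qed
  have tri1: "m p q \<le> d p p' + m p' q" if "p \<in> M" "p' \<in> M" "q \<in> M" for p p' q
  proof -
    obtain c where c: "c \<in> C" "m p' q = d p' (fst c) + w c + d (snd c) q" using m_ex by blast
    then show ?thesis using m_le[OF c(1), of p q] triangle[of p p' "fst c"] CM[OF c(1)] that by auto
  qed
  have tri2: "m p q \<le> m p q' + d q' q" if "p \<in> M" "q' \<in> M" "q \<in> M" for p q' q
  proof -
    obtain c where c: "c \<in> C" "m p q' = d p (fst c) + w c + d (snd c) q'" using m_ex by blast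
    then show ?thesis using m_le[OF c(1), of p q] triangle[of "snd c" q' q] CM[OF c(1)] that by auto
  qed
  \<comment> \<open>A detour through the other copy is no shortcut: it crosses two bridges, and by
    \<open>bridge\<close> their lengths pay for whatever the other copy saves. Thus both copies keep
    the metric \<open>d\<close>.\<close>
  have tri3: "d p p' \<le> m p q + m p' q" if "p \<in> M" "p' \<in> M" "q \<in> M" for p p' q
  proof -
    obtain c where c: "c \<in> C" "m p q = d p (fst c) + w c + d (snd c) q" using m_ex by blast
    obtain c' where c': "c' \<in> C" "m p' q = d p' (fst c') + w c' + d (snd c') q" using m_ex by blast
    show ?thesis
      using c c' bridge[OF c(1) c'(1)] that CM[OF c(1)] CM[OF c'(1)] commute[of p' "fst c'"]
        triangle[of p "fst c" p'] triangle[of "fst c" "fst c'" p'] triangle[of "snd c" q "snd c'"]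
        commute[of q "snd c'"]
      by auto
  qed
  have tri4: "d q q' \<le> m p q + m p q'" if "q \<in> M" "q' \<in> M" "p \<in> M" for p q q'
  proof -
    obtain c where c: "c \<in> C" "m p q = d p (fst c) + w c + d (snd c) q" using m_ex by blast
    obtain c' where c': "c' \<in> C" "m p q' = d p (fst c') + w c' + d (snd c') q'" using m_ex by blast
    show ?thesis
      using c c' bridge[OF c(1) c'(1)] that CM[OF c(1)] CM[OF c'(1)] commute[of q "snd c"]
        triangle[of q "snd c" q'] triangle[of "snd c" "snd c'" q'] triangle[of "fst c" p "fst c'"]
        commute[of p "fst c"]
      by auto
  qed
  have IM: "(\<forall>p. i = Inl p \<longrightarrow> p \<in> M) \<and> (\<forall>p. i = Inr p \<longrightarrow> p \<in> M)" if "i \<in> I" for i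
    using that A xy by (auto simp: I_def)
  \<comment> \<open>The first copy already lies in \<open>M\<close> and is kept fixed by
    \<open>projl\<close>; only the points of the second copy have to be found.\<close>
  have "\<exists>g. (\<forall>i\<in>I. g i \<in> M) \<and> (\<forall>i\<in>I. \<forall>j\<in>I. d (g i) (g j) = \<rho> i j) \<and>
      (\<forall>i\<in>Inl ` insert y A. g i = projl i)"
  proof (rule pseudometric_extension[OF inj])
    show "finite I" using A by (simp add: I_def)
    show "\<rho> i i = 0" if "i \<in> I" for i using IM[OF that] by (cases i) (auto simp: \<rho>_def)
    show "\<rho> i j = \<rho> j i" for i j by (cases i; cases j) (auto simp: \<rho>_def commute)
    show "\<rho> i k \<le> \<rho> i j + \<rho> j k" if "i \<in> I" "j \<in> I" "k \<in> I" for i j k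
    proof (cases i; cases j; cases k)
      fix p q r assume *: "i = Inl p" "j = Inl q" "k = Inl r"
      then show ?thesis using IM[OF that(1)] IM[OF that(2)] IM[OF that(3)] triangle[of p q r]
        by (auto simp: \<rho>_def)
    next
      fix p q r assume *: "i = Inl p" "j = Inl q" "k = Inr r"
      then show ?thesis using IM[OF that(1)] IM[OF that(2)] IM[OF that(3)] tri1[of p q r]
        by (auto simp: \<rho>_def)
    next
      fix p q r assume *: "i = Inl p" "j = Inr q" "k = Inl r"
      then show ?thesis using IM[OF that(1)] IM[OF that(2)] IM[OF that(3)] tri3[of p r q]
        by (auto simp: \<rho>_def)
    next
      fix p q r assume *: "i = Inl p" "j = Inr q" "k = Inr r"
      then show ?thesis using IM[OF that(1)] IM[OF that(2)] IM[OF that(3)] tri2[of p q r]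
        by (auto simp: \<rho>_def)
    next
      fix p q r assume *: "i = Inr p" "j = Inl q" "k = Inl r"
      then show ?thesis using IM[OF that(1)] IM[OF that(2)] IM[OF that(3)] tri1[of r q p] commute[of r q]
        by (auto simp: \<rho>_def)
    next
      fix p q r assume *: "i = Inr p" "j = Inl q" "k = Inr r"
      then show ?thesis using IM[OF that(1)] IM[OF that(2)] IM[OF that(3)] tri4[of p r q]
        by (auto simp: \<rho>_def)
    next
      fix p q r assume *: "i = Inr p" "j = Inr q" "k = Inl r"
      then show ?thesis using IM[OF that(1)] IM[OF that(2)] IM[OF that(3)] tri2[of r q p] commute[of p q]
        by (auto simp: \<rho>_def)
    next
      fix p q r assume *: "i = Inr p" "j = Inr q" "k = Inr r"
      then show ?thesis using IM[OF that(1)] IM[OF that(2)] IM[OF that(3)] triangle[of p q r]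
        by (auto simp: \<rho>_def)
    qed
    show "Inl ` insert y A \<subseteq> I" by (auto simp: I_def)
    show "projl i \<in> M" if "i \<in> Inl ` insert y A" for i using that A xy by auto
    show "d (projl i) (projl j) = \<rho> i j" if "i \<in> Inl ` insert y A" "j \<in> Inl ` insert y A" for i j
      using that by (auto simp: \<rho>_def)
  qed
  then obtain g where g: "\<And>i. i \<in> I \<Longrightarrow> g i \<in> M" "\<And>i j. \<lbrakk>i \<in> I; j \<in> I\<rbrakk> \<Longrightarrow> d (g i) (g j) = \<rho> i j"
    "\<And>p. p \<in> insert y A \<Longrightarrow> g (Inl p) = p"
    by fastforce
  have gx: "g (Inr x) = y"
  proof -
    have "d (g (Inr x)) y = m y x"
      using g(2)[of "Inr x" "Inl y"] g(3)[of y] by (simp add: I_def \<rho>_def)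
    also have "\<dots> \<le> 0" using m_le[of "(y, x)" y x] xy by (simp add: C_def w_def)
    finally show ?thesis using g(1)[of "Inr x"] xy nonneg[of "g (Inr x)" y] by (simp add: I_def)
  qed
  have ga: "d (g (Inr a)) a \<le> \<delta>" if "a \<in> A" for a
  proof -
    have "d (g (Inr a)) a = m a a"
      using g(2)[of "Inr a" "Inl a"] g(3)[of a] that by (simp add: I_def \<rho>_def)
    also have "\<dots> \<le> \<delta>" using m_le[of "(a, a)" a a] that A \<delta> by (auto simp: C_def w_def split: if_splits)
    finally show ?thesis .
  qed
  \<comment> \<open>On the second copy \<rho> is \<open>d\<close>, so sending each point to its
    realisation is a finite partial isometry, which ultrahomogeneity extends to all of
    \<open>M\<close>.\<close>
  have "partial_isometry ((\<lambda>q. (q, g (Inr q))) ` insert x A)"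
    unfolding partial_isometry_def using g(1,2) A xy by (auto simp: I_def \<rho>_def)
  then obtain h where "h \<in> carrier (isometry_group M d)" "\<And>q. q \<in> insert x A \<Longrightarrow> h q = g (Inr q)"
    using ultrahomogeneous[OF inj complete sep, of "(\<lambda>q. (q, g (Inr q))) ` insert x A"] A by auto
  then show ?thesis using gx ga by (metis insertI1 insertI2)
qed


section \<open>The isometry group as a topological group\<close>

abbreviation Iso :: "('a \<Rightarrow> 'a) monoid" where "Iso \<equiv> isometry_group M d"
abbreviation Iso_topology :: "('a \<Rightarrow> 'a) topology" where
  "Iso_topology \<equiv> isometry_group_topology M d"

lemma Iso_carrier: "carrier Iso = {g \<in> Bij M. \<forall>x\<in>M. \<forall>y\<in>M. d (g x) (g y) = d x y}"
  by (simp add: isometry_group_def)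

lemma IsoD:
  assumes "g \<in> carrier Iso"
  shows "x \<in> M \<Longrightarrow> g x \<in> M" "\<lbrakk>x \<in> M; y \<in> M\<rbrakk> \<Longrightarrow> d (g x) (g y) = d x y"
    "g \<in> extensional M" "g \<in> Bij M" "bij_betw g M M"
  using assms by (auto simp: Iso_carrier Bij_def bij_betw_def)

lemma subgroup_Iso: "subgroup (carrier Iso) (BijGroup M)"
proof (rule group.subgroupI[OF group_BijGroup])
  show "carrier Iso \<subseteq> carrier (BijGroup M)" by (auto simp: Iso_carrier BijGroup_def)
  show "carrier Iso \<noteq> {}"
  proof -
    have "(\<lambda>x\<in>M. x) \<in> carrier Iso" by (simp add: Iso_carrier id_Bij)
    then show ?thesis by blast
  qed
next
  fix g assume g: "g \<in> carrier Iso"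
  have "d (inv_into M g x) (inv_into M g y) = d x y" if "x \<in> M" "y \<in> M" for x y
    using IsoD(2)[OF g, of "inv_into M g x" "inv_into M g y"] IsoD(4,5)[OF g] that Bij_inv_into_mem[of g M]
    by (simp add: bij_betw_inv_into_right)
  then have "\<forall>x\<in>M. \<forall>y\<in>M. d (restrict (inv_into M g) M x) (restrict (inv_into M g) M y) = d x y"
    by simp
  then show "inv\<^bsub>BijGroup M\<^esub> g \<in> carrier Iso"
    using IsoD(4)[OF g] restrict_inv_into_Bij[OF IsoD(4)[OF g]]
    by (simp add: inv_BijGroup Iso_carrier del: restrict_apply)
next
  fix g h assume gh: "g \<in> carrier Iso" "h \<in> carrier Iso"
  have "d (compose M g h x) (compose M g h y) = d x y" if "x \<in> M" "y \<in> M" for x y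
    using IsoD(1,2)[OF gh(2)] IsoD(2)[OF gh(1)] that by (simp add: compose_eq)
  then show "g \<otimes>\<^bsub>BijGroup M\<^esub> h \<in> carrier Iso"
    using IsoD(4)[OF gh(1)] IsoD(4)[OF gh(2)] by (simp add: Iso_carrier BijGroup_def compose_Bij)
qed

lemma group_Iso: "group Iso"
  using group.subgroup_imp_group[OF group_BijGroup subgroup_Iso] by (simp add: isometry_group_def)

lemma Iso_mult: "\<lbrakk>g \<in> carrier Iso; h \<in> carrier Iso\<rbrakk> \<Longrightarrow> g \<otimes>\<^bsub>Iso\<^esub> h = compose M g h"
  using IsoD(4)[of g] IsoD(4)[of h] by (simp add: isometry_group_def BijGroup_def)

lemma Iso_one: "\<one>\<^bsub>Iso\<^esub> = (\<lambda>x\<in>M. x)"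
  by (simp add: isometry_group_def BijGroup_def)

lemma Iso_inv:
  assumes "g \<in> carrier Iso" "x \<in> M"
  shows "(inv\<^bsub>Iso\<^esub> g) x \<in> M" "g ((inv\<^bsub>Iso\<^esub> g) x) = x" "(inv\<^bsub>Iso\<^esub> g) (g x) = x"
proof -
  interpret group Iso by (rule group_Iso)
  have i: "inv\<^bsub>Iso\<^esub> g \<in> carrier Iso" using assms by simp
  then show "(inv\<^bsub>Iso\<^esub> g) x \<in> M" by (rule IsoD(1)[OF _ assms(2)])
  show "g ((inv\<^bsub>Iso\<^esub> g) x) = x" "(inv\<^bsub>Iso\<^esub> g) (g x) = x"
    using fun_cong[OF r_inv[OF assms(1)], of x] fun_cong[OF l_inv[OF assms(1)], of x] assms(2)
    unfolding Iso_mult[OF assms(1) i] Iso_mult[OF i assms(1)] Iso_one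
    by (simp_all add: compose_eq)
qed

lemma topspace_Iso_topology [simp]: "topspace Iso_topology = carrier Iso"
proof -
  have "g \<in> (\<Pi>\<^sub>E x\<in>M. M)" if "g \<in> carrier Iso" for g
    using IsoD(1)[OF that] IsoD(3)[OF that] by (simp add: PiE_iff)
  then show ?thesis by (auto simp: isometry_group_topology_def)
qed

section \<open>Basic neighbourhoods and continuity of the operations\<close>

lemma openin_Iso_nbhd:
  assumes "finite A" "A \<subseteq> M" "g \<in> carrier Iso"
  shows "openin Iso_topology {h \<in> carrier Iso. \<forall>a\<in>A. d (g a) (h a) < \<delta>}"
proof -
  let ?U = "\<lambda>a. if a \<in> A then mball (g a) \<delta> else M"
  have "finite {a \<in> M. ?U a \<noteq> M}" by (rule finite_subset[OF _ assms(1)]) auto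
  then have "openin (product_topology (\<lambda>_. mtopology) M) (Pi\<^sub>E M ?U)"
    by (auto simp: openin_PiE_gen)
  moreover have "{h \<in> carrier Iso. \<forall>a\<in>A. d (g a) (h a) < \<delta>} = Pi\<^sub>E M ?U \<inter> carrier Iso"
  proof (intro Set.set_eqI)
    fix h
    show "h \<in> {h \<in> carrier Iso. \<forall>a\<in>A. d (g a) (h a) < \<delta>} \<longleftrightarrow> h \<in> Pi\<^sub>E M ?U \<inter> carrier Iso"
    proof (cases "h \<in> carrier Iso")
      case True
      then show ?thesis
        using IsoD(1)[OF True] IsoD(3)[OF True] IsoD(1)[OF assms(3)] assms(2) by (auto simp: PiE_iff)
    qed simp
  qed
  ultimately show ?thesis unfolding isometry_group_topology_def openin_subtopology by blast
qed

lemma Iso_nbhd_base: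
  assumes "openin Iso_topology V" "g \<in> V"
  shows "\<exists>A \<delta>. finite A \<and> A \<subseteq> M \<and> \<delta> > 0 \<and> (\<forall>h\<in>carrier Iso. (\<forall>a\<in>A. d (g a) (h a) < \<delta>) \<longrightarrow> h \<in> V)"
proof -
  obtain W where W: "openin (product_topology (\<lambda>_. mtopology) M) W" "V = W \<inter> carrier Iso"
    using assms(1) unfolding isometry_group_topology_def openin_subtopology by blast
  then obtain U where U: "finite {a \<in> M. U a \<noteq> M}" "\<And>a. a \<in> M \<Longrightarrow> openin mtopology (U a)"
      "g \<in> Pi\<^sub>E M U" "Pi\<^sub>E M U \<subseteq> W"
    using assms(2) unfolding openin_product_topology_alt by fastforce
  define A where "A = {a \<in> M. U a \<noteq> M}"
  have "\<exists>r>0. mball (g a) r \<subseteq> U a" if "a \<in> A" for a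
    using U(2)[of a] U(3) that unfolding openin_mtopology A_def by blast
  then obtain r where r: "\<And>a. a \<in> A \<Longrightarrow> r a > 0" "\<And>a. a \<in> A \<Longrightarrow> mball (g a) (r a) \<subseteq> U a" by metis
  \<comment> \<open>The added 1 keeps the minimum defined and positive when \<open>A\<close> is
    empty.\<close>
  define \<delta> where "\<delta> = Min (insert 1 (r ` A))"
  have fin: "finite A" using U(1) by (simp add: A_def)
  then have \<delta>: "\<delta> > 0" "\<And>a. a \<in> A \<Longrightarrow> \<delta> \<le> r a" using r(1) by (auto simp: \<delta>_def)
  have "h \<in> V" if h: "h \<in> carrier Iso" "\<forall>a\<in>A. d (g a) (h a) < \<delta>" for h
  proof -
    have "h a \<in> U a" if "a \<in> M" for a
    proof (cases "a \<in> A")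
      case True
      have "g \<in> carrier Iso" using assms(2) W(2) by blast
      then have "g a \<in> M" using IsoD(1) that by simp
      then have "h a \<in> mball (g a) (r a)" using h(2) \<delta>(2)[OF True] True IsoD(1)[OF h(1) that] by fastforce
      then show ?thesis using r(2)[OF True] by blast
    next
      case False
      then show ?thesis using IsoD(1)[OF h(1) that] that by (simp add: A_def)
    qed
    then have "h \<in> Pi\<^sub>E M U" using IsoD(3)[OF h(1)] by (simp add: PiE_iff)
    then show ?thesis using U(4) W(2) h(1) by blast
  qed
  then show ?thesis using fin \<delta>(1) by (intro exI[of _ A] exI[of _ \<delta>]) (auto simp: A_def)
qed

lemma continuous_map_Iso_eval: "x \<in> M \<Longrightarrow> continuous_map Iso_topology mtopology (\<lambda>g. g x)"
  unfolding isometry_group_topology_def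
  by (intro continuous_map_from_subtopology continuous_map_product_projection)

text \<open>Joint continuity comes from equicontinuity: \<open>d (g x) (h y)\<close> is at most
  \<open>d (g x) (h x) + d x y\<close>, because \<open>h\<close> preserves distances.\<close>

lemma continuous_map_Iso_action:
  "continuous_map (prod_topology Iso_topology mtopology) mtopology (\<lambda>(g, x). g x)"
  unfolding continuous_map_to_metric
proof (intro ballI allI impI)
  fix p and \<epsilon> :: real assume "p \<in> topspace (prod_topology Iso_topology mtopology)" and \<epsilon>: "\<epsilon> > 0"
  then obtain g x where p: "p = (g, x)" "g \<in> carrier Iso" "x \<in> M" by auto
  define U where "U = {h \<in> carrier Iso. \<forall>a\<in>{x}. d (g a) (h a) < \<epsilon> / 2} \<times> mball x (\<epsilon> / 2)"
  have "openin (prod_topology Iso_topology mtopology) U"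
    unfolding U_def using openin_Iso_nbhd[of "{x}" g "\<epsilon> / 2"] p by (auto simp: openin_prod_Times_iff)
  moreover have "p \<in> U" using p \<epsilon> IsoD(1)[of g x] by (simp add: U_def)
  moreover have "h y \<in> mball (g x) \<epsilon>" if "(h, y) \<in> U" for h y
    using that triangle[of "g x" "h x" "h y"] IsoD(1)[of h] IsoD(1)[of g] IsoD(2)[of h x y] p
    by (auto simp: U_def)
  ultimately show "\<exists>U. openin (prod_topology Iso_topology mtopology) U \<and> p \<in> U \<and>
      (\<forall>q\<in>U. (case q of (g, x) \<Rightarrow> g x) \<in> mball (case p of (g, x) \<Rightarrow> g x) \<epsilon>)"
    using p by auto
qed

text \<open>Both operations are checked at each point \<open>x\<close>. For the product,
  \<open>x\<close> is sent to the value of \<open>g\<close> at \<open>h x\<close>, so continuity of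
  the action applies. For inverses, with \<open>a\<close> the preimage of \<open>x\<close> under
  \<open>g\<close>, applying \<open>h\<close> turns the distance between the two preimages of
  \<open>x\<close> into \<open>d (h a) x\<close>, and \<open>x = g a\<close>.\<close>

lemma topological_group_Iso: "topological_group Iso Iso_topology"
  unfolding topological_group_def
proof (intro conjI)
  show "group Iso" by (rule group_Iso)
  interpret group Iso by (rule group_Iso)
  show "topspace Iso_topology = carrier Iso" by simp
  show "continuous_map (prod_topology Iso_topology Iso_topology) Iso_topology (\<lambda>(g, h). g \<otimes>\<^bsub>Iso\<^esub> h)"
    unfolding isometry_group_topology_def[of M d] continuous_map_in_subtopology continuous_map_componentwise
    unfolding isometry_group_topology_def[of M d, symmetric]
  proof (intro conjI ballI)
    show "(\<lambda>(g, h). g \<otimes>\<^bsub>Iso\<^esub> h) ` topspace (prod_topology Iso_topology Iso_topology) \<subseteq> extensional M"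
      using IsoD(3) by auto
    show "(\<lambda>(g, h). g \<otimes>\<^bsub>Iso\<^esub> h) \<in> topspace (prod_topology Iso_topology Iso_topology) \<rightarrow> carrier Iso"
      by auto
    fix x assume x: "x \<in> M"
    have "continuous_map (prod_topology Iso_topology Iso_topology) mtopology
        ((\<lambda>(g, y). g y) \<circ> (\<lambda>p. (fst p, snd p x)))"
      by (intro continuous_map_compose[OF _ continuous_map_Iso_action] continuous_map_pairedI
          continuous_map_fst continuous_map_compose[OF continuous_map_snd continuous_map_Iso_eval[OF x], unfolded o_def])
    then show "continuous_map (prod_topology Iso_topology Iso_topology) mtopology
        (\<lambda>p. (case p of (g, h) \<Rightarrow> g \<otimes>\<^bsub>Iso\<^esub> h) x)"
      by (rule continuous_map_eq) (use x in \<open>auto simp: Iso_mult compose_eq\<close>)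
  qed
  show "continuous_map Iso_topology Iso_topology (\<lambda>g. inv\<^bsub>Iso\<^esub> g)"
    unfolding isometry_group_topology_def[of M d] continuous_map_in_subtopology continuous_map_componentwise
    unfolding isometry_group_topology_def[of M d, symmetric]
  proof (intro conjI ballI)
    show "(\<lambda>g. inv\<^bsub>Iso\<^esub> g) ` topspace Iso_topology \<subseteq> extensional M"
      using IsoD(3) by auto
    show "(\<lambda>g. inv\<^bsub>Iso\<^esub> g) \<in> topspace Iso_topology \<rightarrow> carrier Iso" by auto
    fix x assume x: "x \<in> M"
    show "continuous_map Iso_topology mtopology (\<lambda>g. (inv\<^bsub>Iso\<^esub> g) x)"
      unfolding continuous_map_to_metric
    proof (intro ballI allI impI)
      fix g and \<epsilon> :: real assume g: "g \<in> topspace Iso_topology" and \<epsilon>: "\<epsilon> > 0"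
      let ?a = "(inv\<^bsub>Iso\<^esub> g) x"
      let ?U = "{h \<in> carrier Iso. \<forall>a\<in>{?a}. d (g a) (h a) < \<epsilon>}"
      have a: "?a \<in> M" "g ?a = x" using g x Iso_inv by auto
      have "(inv\<^bsub>Iso\<^esub> h) x \<in> mball ?a \<epsilon>" if "h \<in> ?U" for h
      proof -
        have h: "h \<in> carrier Iso" "d (g ?a) (h ?a) < \<epsilon>" using that by auto
        have "d ?a ((inv\<^bsub>Iso\<^esub> h) x) = d (h ?a) x"
          using IsoD(2)[OF h(1) a(1), of "(inv\<^bsub>Iso\<^esub> h) x"] Iso_inv[OF h(1) x] by simp
        then show ?thesis using h a Iso_inv[OF h(1) x] commute by simp
      qed
      moreover have "openin Iso_topology ?U" using openin_Iso_nbhd[of "{?a}" g] a g by simp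
      ultimately show "\<exists>U. openin Iso_topology U \<and> g \<in> U \<and> (\<forall>h\<in>U. (inv\<^bsub>Iso\<^esub> h) x \<in> mball ?a \<epsilon>)"
        using g \<epsilon> a x by (intro exI[of _ ?U]) auto
    qed
  qed
qed

lemma G_space_Iso: "G_space Iso Iso_topology mtopology (\<lambda>g x. g x)"
  unfolding G_space_def
proof (intro conjI)
  show "group_action Iso (topspace mtopology) (\<lambda>g x. g x)"
  proof -
    have "(\<lambda>g x. g x) \<in> hom Iso (BijGroup M)"
      using subgroup.subset[OF subgroup_Iso] by (auto simp: hom_def isometry_group_def)
    then show ?thesis
      by (simp add: group_action_def group_hom_def group_hom_axioms_def group_Iso group_BijGroup)
  qed
  show "completely_regular_space mtopology"
    by (rule metrizable_imp_completely_regular_space[OF metrizable_space_mtopology])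
qed (use topological_group_Iso continuous_map_Iso_action Hausdorff_space_mtopology in blast)+

end


section \<open>Samuel compactifications\<close>

abbreviation product_reals :: "'i set \<Rightarrow> ('i \<Rightarrow> real) topology" where
  "product_reals I \<equiv> product_topology (\<lambda>_. euclideanreal) I"

lemma continuous_map_real_iff:
  "continuous_map X euclideanreal f \<longleftrightarrow>
    (\<forall>x\<in>topspace X. \<forall>\<epsilon>>0. \<exists>U. openin X U \<and> x \<in> U \<and> (\<forall>y\<in>U. \<bar>f y - f x\<bar> < \<epsilon>))"
  unfolding Met_TC.continuous_map_to_metric[of X f, simplified]
  by (simp add: dist_real_def abs_minus_commute)

lemma samuel_map_in_product: "samuel_map S U x \<in> topspace (product_reals (samuel_algebra S U))"
  by (simp add: samuel_map_def)

lemma topspace_samuel_compactification: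
  "topspace (samuel_compactification S U) =
    product_reals (samuel_algebra S U) closure_of (samuel_map S U ` S)"
  unfolding samuel_compactification_def Let_def
  by (simp add: closure_of_subset_topspace inf.absorb2 flip: topspace_product_topology)

lemma samuel_map_in_topspace: "x \<in> S \<Longrightarrow> samuel_map S U x \<in> topspace (samuel_compactification S U)"
  unfolding topspace_samuel_compactification
  using closure_of_subset[of "samuel_map S U ` S" "product_reals (samuel_algebra S U)"]
    samuel_map_in_product[of S U] by blast

lemma samuel_topspace_extensional:
  "p \<in> topspace (samuel_compactification S U) \<Longrightarrow> p \<in> extensional (samuel_algebra S U)"
  using closure_of_subset_topspace[of "product_reals (samuel_algebra S U)" "samuel_map S U ` S"]
  unfolding topspace_samuel_compactification by (auto simp: PiE_iff)

lemma samuel_map_dense: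
  "samuel_compactification S U closure_of (samuel_map S U ` S) = topspace (samuel_compactification S U)"
proof -
  let ?P = "product_reals (samuel_algebra S U)"
  have "samuel_map S U ` S \<subseteq> ?P closure_of (samuel_map S U ` S)"
    using samuel_map_in_product[of S U] by (intro closure_of_subset) blast
  then show ?thesis
    unfolding topspace_samuel_compactification
    unfolding samuel_compactification_def Let_def closure_of_subtopology
    by (simp add: inf.absorb2)
qed

lemma Hausdorff_space_samuel: "Hausdorff_space (samuel_compactification S U)"
  unfolding samuel_compactification_def Let_def
  by (intro Hausdorff_space_subtopology) (simp add: Hausdorff_space_product_topology)

text \<open>Every member \<open>f\<close> of the algebra is bounded, say by \<open>B f\<close>, so
  the image of \<open>S\<close> lies in a product of compact intervals. This product is compact by
  Tychonoff, and the closure is a closed subset of it.\<close>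

lemma compact_space_samuel: "compact_space (samuel_compactification S U)"
proof -
  let ?A = "samuel_algebra S U"
  let ?P = "product_reals ?A"
  have "\<exists>B. \<forall>x\<in>S. \<bar>f x\<bar> \<le> B" if "f \<in> ?A" for f
    using that unfolding samuel_algebra_def bounded_iff by auto
  then obtain B where B: "\<And>f x. \<lbrakk>f \<in> ?A; x \<in> S\<rbrakk> \<Longrightarrow> \<bar>f x\<bar> \<le> B f" by metis
  let ?Q = "\<Pi>\<^sub>E f\<in>?A. {-B f..B f}"
  have Q: "compactin ?P ?Q" by (simp add: compactin_PiE)
  have "closedin ?P ?Q"
    by (rule compactin_imp_closedin[OF _ Q]) (simp add: Hausdorff_space_product_topology)
  moreover have "samuel_map S U ` S \<subseteq> ?Q"
    using B by (fastforce simp: samuel_map_def abs_le_iff)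
  ultimately have "?P closure_of (samuel_map S U ` S) \<subseteq> ?Q" by (rule closure_of_minimal[rotated])
  then have "compactin ?P (?P closure_of (samuel_map S U ` S))"
    by (rule closed_compactin[OF Q]) simp
  then show ?thesis
    unfolding samuel_compactification_def Let_def by (rule compact_space_subtopology)
qed

lemma continuous_map_samuel_eval:
  assumes "f \<in> samuel_algebra S U"
  shows "continuous_map (samuel_compactification S U) euclideanreal (\<lambda>p. p f)"
  unfolding samuel_compactification_def Let_def
  using assms by (intro continuous_map_from_subtopology continuous_map_product_projection)

text \<open>The inequality is a closed condition on \<open>p\<close> and holds on the dense image of
  \<open>S\<close>. So evaluation is 1-Lipschitz in the supremum norm, uniformly in
  \<open>p\<close>; the joint continuity of the action will rest on this.\<close>

lemma samuel_eval_close: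
  assumes u: "u \<in> samuel_algebra S U" and v: "v \<in> samuel_algebra S U"
    and c: "\<And>x. x \<in> S \<Longrightarrow> \<bar>u x - v x\<bar> \<le> c" and p: "p \<in> topspace (samuel_compactification S U)"
  shows "\<bar>p u - p v\<bar> \<le> c"
proof -
  let ?K = "samuel_compactification S U"
  have "continuous_map ?K euclideanreal (\<lambda>p. p u - p v)"
    by (intro continuous_map_diff continuous_map_samuel_eval u v)
  then have "closedin ?K {p \<in> topspace ?K. p u - p v \<in> {-c..c}}"
    by (rule closedin_continuous_map_preimage) (simp flip: closed_closedin)
  moreover have "samuel_map S U ` S \<subseteq> {p \<in> topspace ?K. p u - p v \<in> {-c..c}}"
    using c u v samuel_map_in_topspace by (fastforce simp: samuel_map_def abs_le_iff)
  ultimately have "topspace ?K \<subseteq> {p \<in> topspace ?K. p u - p v \<in> {-c..c}}"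
    unfolding samuel_map_dense[symmetric] by (rule closure_of_minimal[rotated])
  then have "p \<in> {p \<in> topspace ?K. p u - p v \<in> {-c..c}}" using p by blast
  then show ?thesis by auto
qed


section \<open>The Gromov compactification as an equivariant compactification\<close>

context Metric_space
begin

section \<open>The weak uniformity and its algebra in terms of finite sets of base points\<close>

text \<open>An infimum of filters is generated by the finite subinfima, and finitely many tolerances
  have a positive minimum, so one finite set with one \<delta> describes a basic entourage.\<close>

lemma eventually_weak_uniformity:
  "eventually P (weak_uniformity M d) \<longleftrightarrow>
    (\<exists>A \<delta>. finite A \<and> A \<subseteq> M \<and> \<delta> > 0 \<and>
      (\<forall>x\<in>M. \<forall>y\<in>M. (\<forall>a\<in>A. \<bar>d x a - d y a\<bar> < \<delta>) \<longrightarrow> P (x, y)))" (is "?lhs \<longleftrightarrow> ?rhs")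
proof
  assume ?lhs
  then obtain A where A: "A \<subseteq> M" "finite A"
    and "eventually (\<lambda>p. p \<in> M \<times> M \<longrightarrow> P p)
      (INF z\<in>A. filtercomap (\<lambda>(x, y). (d x z, d y z)) uniformity)"
    unfolding weak_uniformity_def eventually_inf_principal eventually_INF[of _ _ M] by blast
  then obtain Q where Q: "\<And>z. z \<in> A \<Longrightarrow> eventually (Q z) (filtercomap (\<lambda>(x, y). (d x z, d y z)) uniformity)"
      "\<And>p. \<lbrakk>\<forall>z\<in>A. Q z p; p \<in> M \<times> M\<rbrakk> \<Longrightarrow> P p"
    unfolding eventually_INF_finite[OF A(2)] by blast
  have "\<exists>e>0. \<forall>x y. \<bar>d x z - d y z\<bar> < e \<longrightarrow> Q z (x, y)" if "z \<in> A" for z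
    using Q(1)[OF that] unfolding eventually_filtercomap eventually_uniformity_metric dist_real_def
    by fastforce
  then obtain e where e: "\<And>z. z \<in> A \<Longrightarrow> e z > 0"
      "\<And>z x y. \<lbrakk>z \<in> A; \<bar>d x z - d y z\<bar> < e z\<rbrakk> \<Longrightarrow> Q z (x, y)"
    by metis
  define \<delta> where "\<delta> = Min (insert 1 (e ` A))"
  have \<delta>: "\<delta> > 0" "\<And>z. z \<in> A \<Longrightarrow> \<delta> \<le> e z" using e(1) A(2) by (auto simp: \<delta>_def)
  have "P (x, y)" if "x \<in> M" "y \<in> M" "\<forall>a\<in>A. \<bar>d x a - d y a\<bar> < \<delta>" for x y
    using that Q(2)[of "(x, y)"] e(2) \<delta>(2) by fastforce
  then show ?rhs using A \<delta>(1) by blast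
next
  assume ?rhs
  then obtain A \<delta> where A: "finite A" "A \<subseteq> M" "\<delta> > 0"
    and P: "\<And>x y. \<lbrakk>x \<in> M; y \<in> M; \<forall>a\<in>A. \<bar>d x a - d y a\<bar> < \<delta>\<rbrakk> \<Longrightarrow> P (x, y)" by blast
  have "eventually (\<lambda>(x, y). \<bar>d x z - d y z\<bar> < \<delta>) (filtercomap (\<lambda>(x, y). (d x z, d y z)) uniformity)" for z
    unfolding eventually_filtercomap eventually_uniformity_metric dist_real_def
    using A(3) by (intro exI[of _ "\<lambda>(s, t). \<bar>s - t\<bar> < \<delta>"]) auto
  then have "eventually (\<lambda>p. p \<in> M \<times> M \<longrightarrow> P p)
      (INF z\<in>A. filtercomap (\<lambda>(x, y). (d x z, d y z)) uniformity)"
    unfolding eventually_INF_finite[OF A(1)]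
    using P by (intro exI[of _ "\<lambda>z (x, y). \<bar>d x z - d y z\<bar> < \<delta>"]) fastforce
  then show ?lhs
    unfolding weak_uniformity_def eventually_inf_principal eventually_INF[of _ _ M] using A by blast
qed

abbreviation Gromov_algebra :: "('a \<Rightarrow> real) set" where
  "Gromov_algebra \<equiv> samuel_algebra M (weak_uniformity M d)"

lemma Gromov_algebra_iff:
  "f \<in> Gromov_algebra \<longleftrightarrow> f \<in> extensional M \<and> bounded (f ` M) \<and>
    (\<forall>\<epsilon>>0. \<exists>A \<delta>. finite A \<and> A \<subseteq> M \<and> \<delta> > 0 \<and>
      (\<forall>x\<in>M. \<forall>y\<in>M. (\<forall>a\<in>A. \<bar>d x a - d y a\<bar> < \<delta>) \<longrightarrow> \<bar>f x - f y\<bar> < \<epsilon>))"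
proof -
  have "(LIM (x, y) weak_uniformity M d. (f x, f y) :> uniformity) \<longleftrightarrow>
      (\<forall>\<epsilon>>0. eventually (\<lambda>(x, y). \<bar>f x - f y\<bar> < \<epsilon>) (weak_uniformity M d))"
  proof safe
    fix \<epsilon> :: real assume "LIM (x, y) weak_uniformity M d. (f x, f y) :> uniformity" "\<epsilon> > 0"
    moreover have "eventually (\<lambda>(s, t). \<bar>s - t\<bar> < \<epsilon>) (uniformity :: (real \<times> real) filter)"
      using \<open>\<epsilon> > 0\<close> unfolding eventually_uniformity_metric dist_real_def by auto
    ultimately have "eventually (\<lambda>p. case (case p of (x, y) \<Rightarrow> (f x, f y)) of (s, t) \<Rightarrow> \<bar>s - t\<bar> < \<epsilon>)
        (weak_uniformity M d)"
      unfolding filterlim_iff by blast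
    then show "eventually (\<lambda>(x, y). \<bar>f x - f y\<bar> < \<epsilon>) (weak_uniformity M d)"
      by (simp add: case_prod_unfold)
  next
    assume *: "\<forall>\<epsilon>>0. eventually (\<lambda>(x, y). \<bar>f x - f y\<bar> < \<epsilon>) (weak_uniformity M d)"
    show "LIM (x, y) weak_uniformity M d. (f x, f y) :> uniformity"
      unfolding filterlim_iff
    proof (intro allI impI)
      fix P :: "real \<times> real \<Rightarrow> bool" assume "eventually P uniformity"
      then obtain \<epsilon> where "\<epsilon> > 0" "\<And>s t. \<bar>s - t\<bar> < \<epsilon> \<Longrightarrow> P (s, t)"
        unfolding eventually_uniformity_metric dist_real_def by blast
      then show "eventually (\<lambda>p. P (case p of (x, y) \<Rightarrow> (f x, f y))) (weak_uniformity M d)"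
        using *[rule_format, of \<epsilon>] by (auto elim!: eventually_mono)
    qed
  qed
  then show ?thesis unfolding samuel_algebra_def eventually_weak_uniformity by auto
qed

lemma Gromov_algebraE:
  assumes "f \<in> Gromov_algebra" "\<epsilon> > 0"
  obtains A \<delta> where "finite A" "A \<subseteq> M" "\<delta> > 0"
    "\<And>x y. \<lbrakk>x \<in> M; y \<in> M; \<And>a. a \<in> A \<Longrightarrow> \<bar>d x a - d y a\<bar> < \<delta>\<rbrakk> \<Longrightarrow> \<bar>f x - f y\<bar> < \<epsilon>"
  using assms unfolding Gromov_algebra_iff by metis

text \<open>Moves an isometry from the variable point to the base point, so that a condition on the
  translate of \<open>x\<close> becomes one on \<open>x\<close> with another finite set of base
  points.\<close>

lemma Iso_dist_inv:
  assumes "g \<in> carrier Iso" "x \<in> M" "a \<in> M"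
  shows "d (g x) a = d x ((inv\<^bsub>Iso\<^esub> g) a)"
  using IsoD(2)[OF assms(1,2) Iso_inv(1)[OF assms(1,3)]] Iso_inv(2)[OF assms(1,3)] by simp

text \<open>If \<open>A\<close> and \<delta> witness uniform continuity of \<open>f\<close>, then
  the preimage of \<open>A\<close> under \<open>g\<close>, with the same \<delta>, witnesses it for
  the translate.\<close>

lemma Gromov_algebra_translate:
  assumes f: "f \<in> Gromov_algebra" and g: "g \<in> carrier Iso"
  shows "compose M f g \<in> Gromov_algebra"
  unfolding Gromov_algebra_iff
proof (intro conjI allI impI)
  show "compose M f g \<in> extensional M" by simp
  have "compose M f g ` M \<subseteq> f ` M" using IsoD(1)[OF g] by (auto simp: compose_eq)
  then show "bounded (compose M f g ` M)" using f bounded_subset unfolding Gromov_algebra_iff by blast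
  fix \<epsilon> :: real assume "\<epsilon> > 0"
  then obtain A \<delta> where A: "finite A" "A \<subseteq> M" "\<delta> > 0"
    "\<And>x y. \<lbrakk>x \<in> M; y \<in> M; \<And>a. a \<in> A \<Longrightarrow> \<bar>d x a - d y a\<bar> < \<delta>\<rbrakk> \<Longrightarrow> \<bar>f x - f y\<bar> < \<epsilon>"
    using Gromov_algebraE[OF f] by metis
  let ?B = "(inv\<^bsub>Iso\<^esub> g) ` A"
  have "?B \<subseteq> M" using Iso_inv(1)[OF g] A(2) by blast
  moreover have "\<bar>compose M f g x - compose M f g y\<bar> < \<epsilon>"
    if "x \<in> M" "y \<in> M" "\<forall>b\<in>?B. \<bar>d x b - d y b\<bar> < \<delta>" for x y
  proof -
    have "\<bar>d (g x) a - d (g y) a\<bar> < \<delta>" if "a \<in> A" for a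
      using Iso_dist_inv[OF g \<open>x \<in> M\<close>, of a] Iso_dist_inv[OF g \<open>y \<in> M\<close>, of a] A(2)
        \<open>\<forall>b\<in>?B. \<bar>d x b - d y b\<bar> < \<delta>\<close> that by auto
    then show ?thesis using A(4)[of "g x" "g y"] IsoD(1)[OF g] that by (simp add: compose_eq)
  qed
  ultimately show "\<exists>A \<delta>. finite A \<and> A \<subseteq> M \<and> \<delta> > 0 \<and>
      (\<forall>x\<in>M. \<forall>y\<in>M. (\<forall>a\<in>A. \<bar>d x a - d y a\<bar> < \<delta>) \<longrightarrow> \<bar>compose M f g x - compose M f g y\<bar> < \<epsilon>)"
    using A(1,3) by (intro exI[of _ ?B] exI[of _ \<delta>]) auto
qed

text \<open>For a base point \<open>a = g b\<close>, both \<open>g\<close> and \<open>h\<close>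
  preserve distances, so \<open>d (g x) a = d x b = d (h x) (h b)\<close>. Hence
  \<open>d (h x) a\<close> and \<open>d (g x) a\<close> differ by at most
  \<open>d (g b) (h b)\<close>, a bound free of \<open>x\<close>, and a pointwise neighbourhood of
  \<open>g\<close> suffices for all \<open>x\<close> at once.\<close>

lemma Gromov_algebra_orbit_continuous:
  assumes f: "f \<in> Gromov_algebra" and g: "g \<in> carrier Iso" and \<epsilon>: "\<epsilon> > 0"
  obtains U where "openin Iso_topology U" "g \<in> U"
    "\<And>h x. \<lbrakk>h \<in> U; x \<in> M\<rbrakk> \<Longrightarrow> \<bar>f (h x) - f (g x)\<bar> < \<epsilon>"
proof -
  obtain A \<delta> where A: "finite A" "A \<subseteq> M" "\<delta> > 0"
    "\<And>x y. \<lbrakk>x \<in> M; y \<in> M; \<And>a. a \<in> A \<Longrightarrow> \<bar>d x a - d y a\<bar> < \<delta>\<rbrakk> \<Longrightarrow> \<bar>f x - f y\<bar> < \<epsilon>"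
    using Gromov_algebraE[OF f \<epsilon>] by metis
  let ?B = "(inv\<^bsub>Iso\<^esub> g) ` A"
  let ?U = "{h \<in> carrier Iso. \<forall>b\<in>?B. d (g b) (h b) < \<delta>}"
  have BM: "?B \<subseteq> M" using Iso_inv(1)[OF g] A(2) by blast
  have "openin Iso_topology ?U" using openin_Iso_nbhd[OF _ BM g] A(1) by simp
  moreover have "g \<in> ?U" using g IsoD(1)[OF g] BM A(3) by auto
  moreover have "\<bar>f (h x) - f (g x)\<bar> < \<epsilon>" if h: "h \<in> ?U" and x: "x \<in> M" for h x
  proof (rule A(4))
    have hI: "h \<in> carrier Iso" using h by blast
    show hx: "h x \<in> M" "g x \<in> M" using IsoD(1)[OF hI x] IsoD(1)[OF g x] by auto
    fix a assume a: "a \<in> A"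
    define b where "b = (inv\<^bsub>Iso\<^esub> g) a"
    have b: "b \<in> M" "g b = a" "a \<in> M" using Iso_inv[OF g, of a] a A(2) by (auto simp: b_def)
    have "d (g x) a = d (h x) (h b)"
      using Iso_dist_inv[OF g x b(3)] IsoD(2)[OF hI x b(1)] by (simp add: b_def)
    moreover have "d a (h b) < \<delta>" using h a b(2) by (auto simp: b_def)
    ultimately show "\<bar>d (h x) a - d (g x) a\<bar> < \<delta>"
      using triangle[of "h x" a "h b"] triangle[of "h x" "h b" a] hx b(3) IsoD(1)[OF hI b(1)]
        commute[of a "h b"] by simp
  qed
  ultimately show ?thesis using that by blast
qed

abbreviation Gromov :: "(('a \<Rightarrow> real) \<Rightarrow> real) topology" where
  "Gromov \<equiv> gromov_compactification M d"

lemmas Gromov_compact = compact_space_samuel[of M "weak_uniformity M d", folded gromov_compactification_def]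
lemmas Gromov_Hausdorff = Hausdorff_space_samuel[of M "weak_uniformity M d", folded gromov_compactification_def]
lemmas Gromov_dense = samuel_map_dense[of M "weak_uniformity M d",
    folded gromov_compactification_def gromov_map_def]
lemmas gromov_map_in_topspace = samuel_map_in_topspace[where S = M and U = "weak_uniformity M d",
    folded gromov_compactification_def gromov_map_def]
lemmas Gromov_extensional = samuel_topspace_extensional[where S = M and U = "weak_uniformity M d",
    folded gromov_compactification_def]
lemmas Gromov_eval = continuous_map_samuel_eval[where S = M and U = "weak_uniformity M d",
    folded gromov_compactification_def]
lemmas Gromov_eval_close = samuel_eval_close[where S = M and U = "weak_uniformity M d",
    folded gromov_compactification_def]

lemma gromov_map_apply: "f \<in> Gromov_algebra \<Longrightarrow> gromov_map M d x f = f x"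
  by (simp add: gromov_map_def samuel_map_def)

lemma continuous_map_Gromov:
  assumes "h \<in> topspace X \<rightarrow> topspace Gromov"
    and "\<And>f. f \<in> Gromov_algebra \<Longrightarrow> continuous_map X euclideanreal (\<lambda>x. h x f)"
  shows "continuous_map X Gromov h"
proof -
  have "h ` topspace X \<subseteq> extensional Gromov_algebra"
    using assms(1) Gromov_extensional by blast
  then have "continuous_map X (product_reals Gromov_algebra) h"
    unfolding continuous_map_componentwise using assms(2) by blast
  moreover have "h \<in> topspace X \<rightarrow> product_reals Gromov_algebra closure_of (samuel_map M (weak_uniformity M d) ` M)"
    using assms(1) unfolding gromov_compactification_def topspace_samuel_compactification .
  ultimately show ?thesis
    unfolding gromov_compactification_def samuel_compactification_def Let_def continuous_map_in_subtopology
    by blast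
qed

lemma continuous_map_gromov_map: "continuous_map mtopology Gromov (gromov_map M d)"
proof (rule continuous_map_Gromov)
  show "gromov_map M d \<in> topspace mtopology \<rightarrow> topspace Gromov" using gromov_map_in_topspace by auto
  fix f assume f: "f \<in> Gromov_algebra"
  show "continuous_map mtopology euclideanreal (\<lambda>x. gromov_map M d x f)"
    unfolding gromov_map_apply[OF f] continuous_map_real_iff
  proof (intro ballI allI impI)
    fix x and \<epsilon> :: real assume "x \<in> topspace mtopology" and "\<epsilon> > 0"
    then have x: "x \<in> M" by simp
    obtain A \<delta> where A: "finite A" "A \<subseteq> M" "\<delta> > 0"
      "\<And>x y. \<lbrakk>x \<in> M; y \<in> M; \<And>a. a \<in> A \<Longrightarrow> \<bar>d x a - d y a\<bar> < \<delta>\<rbrakk> \<Longrightarrow> \<bar>f x - f y\<bar> < \<epsilon>"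
      using Gromov_algebraE[OF f \<open>\<epsilon> > 0\<close>] by metis
    have "\<bar>f y - f x\<bar> < \<epsilon>" if y: "y \<in> mball x \<delta>" for y
    proof (rule A(4))
      show "y \<in> M" "x \<in> M" using y by auto
      fix a assume "a \<in> A"
      then have "a \<in> M" using A(2) by blast
      then show "\<bar>d y a - d x a\<bar> < \<delta>"
        using y triangle[of x y a] triangle[of y x a] commute[of x y] by auto
    qed
    then show "\<exists>U. openin mtopology U \<and> x \<in> U \<and> (\<forall>y\<in>U. \<bar>f y - f x\<bar> < \<epsilon>)"
      using x A(3) by (intro exI[of _ "mball x \<delta>"]) auto
  qed
qed

section \<open>The action on the Gromov compactification\<close>

text \<open>A point is a functional on the algebra, and the action is dual to translating functions.
  Translation reverses the order of products and dualising reverses it again, which gives a left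
  action. The outer restriction is there because \<open>BijGroup\<close> consists of extensional
  functions, the inner one because points of the product are extensional.\<close>

definition Gromov_action :: "('a \<Rightarrow> 'a) \<Rightarrow> (('a \<Rightarrow> real) \<Rightarrow> real) \<Rightarrow> (('a \<Rightarrow> real) \<Rightarrow> real)" where
  "Gromov_action g = (\<lambda>p\<in>topspace Gromov. \<lambda>f\<in>Gromov_algebra. p (compose M f g))"

lemma Gromov_action_apply:
  "\<lbrakk>p \<in> topspace Gromov; f \<in> Gromov_algebra\<rbrakk> \<Longrightarrow> Gromov_action g p f = p (compose M f g)"
  by (simp add: Gromov_action_def)

lemma Gromov_action_gromov_map:
  assumes g: "g \<in> carrier Iso" and x: "x \<in> M"
  shows "Gromov_action g (gromov_map M d x) = gromov_map M d (g x)"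
proof
  fix f
  show "Gromov_action g (gromov_map M d x) f = gromov_map M d (g x) f"
  proof (cases "f \<in> Gromov_algebra")
    case True
    then show ?thesis
      using x gromov_map_in_topspace[OF x] gromov_map_apply[OF Gromov_algebra_translate[OF True g]]
      by (simp add: Gromov_action_apply gromov_map_apply compose_eq)
  next
    case False
    then show ?thesis
      using gromov_map_in_topspace[OF x] by (simp add: Gromov_action_def gromov_map_def samuel_map_def)
  qed
qed

text \<open>As a map into the full product the action of \<open>g\<close> is continuous, and it
  sends the dense image of \<open>M\<close> into itself; so it sends the closure into the
  closure.\<close>

lemma Gromov_action_in_topspace:
  assumes g: "g \<in> carrier Iso" and p: "p \<in> topspace Gromov"
  shows "Gromov_action g p \<in> topspace Gromov"
proof -
  let ?P = "product_reals Gromov_algebra"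
  let ?S = "gromov_map M d ` M"
  have "continuous_map Gromov ?P (Gromov_action g)"
    unfolding continuous_map_componentwise
  proof (intro conjI ballI)
    show "Gromov_action g ` topspace Gromov \<subseteq> extensional Gromov_algebra"
      by (auto simp: Gromov_action_def)
    fix f assume f: "f \<in> Gromov_algebra"
    show "continuous_map Gromov euclideanreal (\<lambda>p. Gromov_action g p f)"
      by (rule continuous_map_eq[OF Gromov_eval[OF Gromov_algebra_translate[OF f g]]])
        (simp add: Gromov_action_apply f)
  qed
  then have "Gromov_action g ` (Gromov closure_of ?S) \<subseteq> ?P closure_of (Gromov_action g ` ?S)"
    by (rule continuous_map_image_closure_subset)
  moreover have "Gromov_action g ` ?S \<subseteq> ?S"
    using Gromov_action_gromov_map[OF g] IsoD(1)[OF g] by auto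
  then have "?P closure_of (Gromov_action g ` ?S) \<subseteq> ?P closure_of ?S" by (rule closure_of_mono)
  moreover have "?P closure_of ?S = topspace Gromov"
    by (simp add: gromov_compactification_def topspace_samuel_compactification gromov_map_def)
  ultimately show ?thesis using p Gromov_dense by blast
qed

text \<open>The change from \<open>(g, p)\<close> to \<open>(h, p')\<close> is split at
  \<open>p' (compose M f g)\<close>. The first part is small uniformly in \<open>p'\<close> by norm
  continuity of the orbit of \<open>f\<close>; the second is small by continuity of evaluation at a
  fixed function.\<close>

lemma continuous_map_Gromov_action:
  "continuous_map (prod_topology Iso_topology Gromov) Gromov (\<lambda>(g, p). Gromov_action g p)"
proof (rule continuous_map_Gromov)
  show "(\<lambda>(g, p). Gromov_action g p) \<in> topspace (prod_topology Iso_topology Gromov) \<rightarrow> topspace Gromov"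
    using Gromov_action_in_topspace by auto
  fix f assume f: "f \<in> Gromov_algebra"
  show "continuous_map (prod_topology Iso_topology Gromov) euclideanreal
      (\<lambda>q. (case q of (g, p) \<Rightarrow> Gromov_action g p) f)"
    unfolding continuous_map_real_iff
  proof (intro ballI allI impI)
    fix q and \<epsilon> :: real assume "q \<in> topspace (prod_topology Iso_topology Gromov)" and \<epsilon>: "\<epsilon> > 0"
    then obtain g p where q: "q = (g, p)" "g \<in> carrier Iso" "p \<in> topspace Gromov" by auto
    obtain U where U: "openin Iso_topology U" "g \<in> U"
      "\<And>h x. \<lbrakk>h \<in> U; x \<in> M\<rbrakk> \<Longrightarrow> \<bar>f (h x) - f (g x)\<bar> < \<epsilon> / 2"
      using Gromov_algebra_orbit_continuous[OF f q(2)] \<epsilon> by (metis half_gt_zero)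
    have fg: "compose M f g \<in> Gromov_algebra" by (rule Gromov_algebra_translate[OF f q(2)])
    obtain V where V: "openin Gromov V" "p \<in> V"
        "\<And>p'. p' \<in> V \<Longrightarrow> \<bar>p' (compose M f g) - p (compose M f g)\<bar> < \<epsilon> / 2"
      using Gromov_eval[OF fg] q(3) \<epsilon> unfolding continuous_map_real_iff by (metis half_gt_zero)
    have "\<bar>Gromov_action h p' f - Gromov_action g p f\<bar> < \<epsilon>" if "h \<in> U" "p' \<in> V" for h p'
    proof -
      have h: "h \<in> carrier Iso" using U(1) that(1) openin_subset by fastforce
      have p': "p' \<in> topspace Gromov" using V(1) that(2) openin_subset by blast
      have "\<bar>p' (compose M f h) - p' (compose M f g)\<bar> \<le> \<epsilon> / 2"
        by (rule Gromov_eval_close[OF Gromov_algebra_translate[OF f h] fg _ p'])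
          (use U(3)[OF that(1)] in \<open>simp add: compose_eq less_imp_le\<close>)
      then show ?thesis
        using V(3)[OF that(2)] unfolding Gromov_action_apply[OF p' f] Gromov_action_apply[OF q(3) f]
        by linarith
    qed
    then show "\<exists>W. openin (prod_topology Iso_topology Gromov) W \<and> q \<in> W \<and> (\<forall>q'\<in>W.
        \<bar>(case q' of (g, p) \<Rightarrow> Gromov_action g p) f - (case q of (g, p) \<Rightarrow> Gromov_action g p) f\<bar> < \<epsilon>)"
      using U(1,2) V(1,2) q(1)
      by (intro exI[of _ "U \<times> V"]) (auto simp: openin_prod_Times_iff)
  qed
qed

lemma Gromov_action_one: "Gromov_action \<one>\<^bsub>Iso\<^esub> = (\<lambda>p\<in>topspace Gromov. p)"
proof
  fix p
  have "Gromov_action \<one>\<^bsub>Iso\<^esub> p = p" if p: "p \<in> topspace Gromov"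
  proof
    fix f
    show "Gromov_action \<one>\<^bsub>Iso\<^esub> p f = p f"
    proof (cases "f \<in> Gromov_algebra")
      case True
      then have "compose M f (\<lambda>x\<in>M. x) = f"
        unfolding Gromov_algebra_iff by (auto simp: compose_def extensional_def)
      then show ?thesis using p True by (simp add: Gromov_action_apply Iso_one)
    next
      case False
      then show ?thesis using p extensional_arb[OF Gromov_extensional[OF p] False] by (simp add: Gromov_action_def)
    qed
  qed
  then show "Gromov_action \<one>\<^bsub>Iso\<^esub> p = (\<lambda>p\<in>topspace Gromov. p) p"
    by (simp add: Gromov_action_def)
qed

lemma Gromov_action_mult:
  assumes g: "g \<in> carrier Iso" and h: "h \<in> carrier Iso"
  shows "Gromov_action (g \<otimes>\<^bsub>Iso\<^esub> h) = compose (topspace Gromov) (Gromov_action g) (Gromov_action h)"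
proof
  fix p
  have "Gromov_action (g \<otimes>\<^bsub>Iso\<^esub> h) p = Gromov_action g (Gromov_action h p)" if p: "p \<in> topspace Gromov"
  proof
    fix f
    show "Gromov_action (g \<otimes>\<^bsub>Iso\<^esub> h) p f = Gromov_action g (Gromov_action h p) f"
    proof (cases "f \<in> Gromov_algebra")
      case True
      have "compose M f (compose M g h) = compose M (compose M f g) h"
        using IsoD(1)[OF h] by (auto simp: compose_def)
      then show ?thesis
        using p True Gromov_action_in_topspace[OF h p] Gromov_algebra_translate[OF True g]
        by (simp add: Gromov_action_apply Iso_mult[OF g h])
    next
      case False
      then show ?thesis using p Gromov_action_in_topspace[OF h p] by (simp add: Gromov_action_def)
    qed
  qed
  then show "Gromov_action (g \<otimes>\<^bsub>Iso\<^esub> h) p = compose (topspace Gromov) (Gromov_action g) (Gromov_action h) p"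
    by (cases "p \<in> topspace Gromov") (auto simp: compose_def Gromov_action_def)
qed

lemma group_action_Gromov: "group_action Iso (topspace Gromov) Gromov_action"
proof -
  interpret group Iso by (rule group_Iso)
  have Bij: "Gromov_action g \<in> Bij (topspace Gromov)" if g: "g \<in> carrier Iso" for g
  proof -
    have cancel: "Gromov_action h (Gromov_action h' p) = p"
      if "h \<in> carrier Iso" "h' \<in> carrier Iso" "h \<otimes>\<^bsub>Iso\<^esub> h' = \<one>\<^bsub>Iso\<^esub>" "p \<in> topspace Gromov" for h h' p
      using Gromov_action_mult[OF that(1,2)] Gromov_action_one that by (metis compose_eq restrict_apply')
    have "bij_betw (Gromov_action g) (topspace Gromov) (topspace Gromov)"
      by (rule bij_betwI[where g = "Gromov_action (inv\<^bsub>Iso\<^esub> g)"])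
        (use g Gromov_action_in_topspace cancel in auto)
    then show ?thesis by (auto simp: Bij_def Gromov_action_def)
  qed
  have "Gromov_action \<in> hom Iso (BijGroup (topspace Gromov))"
    using Bij Gromov_action_mult by (auto simp: hom_def BijGroup_def)
  then show ?thesis
    by (simp add: group_action_def group_hom_def group_hom_axioms_def group_Iso group_BijGroup)
qed

theorem equivariant_compactification_Gromov:
  "equivariant_compactification Iso Iso_topology mtopology (\<lambda>g x. g x) Gromov Gromov_action (gromov_map M d)"
  unfolding equivariant_compactification_def
proof (intro conjI)
  show "G_space Iso Iso_topology Gromov Gromov_action"
    unfolding G_space_def
  proof (intro conjI)
    show "completely_regular_space Gromov"
      using locally_compact_regular_imp_completely_regular_space
        [OF compact_imp_locally_compact_space[OF Gromov_compact]] Gromov_Hausdorff by simp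
    show "topological_group Iso Iso_topology" by (rule topological_group_Iso)
    show "Hausdorff_space Gromov" by (rule Gromov_Hausdorff)
    show "group_action Iso (topspace Gromov) Gromov_action" by (rule group_action_Gromov)
    show "continuous_map (prod_topology Iso_topology Gromov) Gromov (\<lambda>(g, p). Gromov_action g p)"
      by (rule continuous_map_Gromov_action)
  qed
  show "\<forall>g\<in>carrier Iso. \<forall>x\<in>topspace mtopology. gromov_map M d (g x) = Gromov_action g (gromov_map M d x)"
    using Gromov_action_gromov_map by auto
  show "Gromov closure_of (gromov_map M d ` topspace mtopology) = topspace Gromov"
    using Gromov_dense by simp
  show "G_space Iso Iso_topology mtopology (\<lambda>g x. g x)" by (rule G_space_Iso)
  show "compact_space Gromov" "Hausdorff_space Gromov" by (rule Gromov_compact Gromov_Hausdorff)+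
  show "continuous_map mtopology Gromov (gromov_map M d)" by (rule continuous_map_gromov_map)
qed


section \<open>Maximality and failure of metrizability\<close>

text \<open>The displacement of \<open>f\<close> under the action is jointly continuous and vanishes
  on the slice over the identity. As \<open>K\<close> is compact, the tube lemma gives one
  neighbourhood of the identity on which it stays below \<epsilon> on all of
  \<open>K\<close>.\<close>

lemma equivariant_compactification_right_uniform:
  assumes ec: "equivariant_compactification Iso Iso_topology mtopology (\<lambda>g x. g x) K \<psi> \<nu>"
    and f: "continuous_map K euclideanreal f" and \<epsilon>: "\<epsilon> > 0"
  obtains A \<delta> where "finite A" "A \<subseteq> M" "\<delta> > 0"
    "\<And>g x. \<lbrakk>g \<in> carrier Iso; x \<in> M; \<And>a. a \<in> A \<Longrightarrow> d a (g a) < \<delta>\<rbrakk> \<Longrightarrow> \<bar>f (\<nu> (g x)) - f (\<nu> x)\<bar> < \<epsilon>"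
proof -
  interpret group Iso by (rule group_Iso)
  have compact: "compact_space K" and \<nu>: "continuous_map mtopology K \<nu>"
    and equiv: "\<And>g x. \<lbrakk>g \<in> carrier Iso; x \<in> M\<rbrakk> \<Longrightarrow> \<nu> (g x) = \<psi> g (\<nu> x)"
    and cont: "continuous_map (prod_topology Iso_topology K) K (\<lambda>(g, x). \<psi> g x)"
    and act: "group_action Iso (topspace K) \<psi>"
    using ec by (auto simp: equivariant_compactification_def G_space_def)
  let ?h = "\<lambda>p. f (\<psi> (fst p) (snd p)) - f (snd p)"
  let ?W = "{p \<in> topspace (prod_topology Iso_topology K). ?h p \<in> {-\<epsilon><..<\<epsilon>}}"
  have "continuous_map (prod_topology Iso_topology K) K (\<lambda>p. \<psi> (fst p) (snd p))"
    using cont by (simp add: case_prod_unfold)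
  then have "continuous_map (prod_topology Iso_topology K) euclideanreal ?h"
    using continuous_map_compose[OF _ f] continuous_map_snd
    by (intro continuous_map_diff) (force simp: o_def)+
  then have W: "openin (prod_topology Iso_topology K) ?W"
    by (rule openin_continuous_map_preimage) (simp flip: open_openin)
  have one: "\<psi> \<one>\<^bsub>Iso\<^esub> k = k" if "k \<in> topspace K" for k
    using group_action.id_eq_one[OF act] that by (metis restrict_apply')
  have "{\<one>\<^bsub>Iso\<^esub>} \<times> topspace K \<subseteq> ?W" using one \<epsilon> by auto
  then obtain U V where UV: "openin Iso_topology U" "\<one>\<^bsub>Iso\<^esub> \<in> U" "topspace K \<subseteq> V" "U \<times> V \<subseteq> ?W"
    using tube_lemma_right[OF W, of "topspace K" "\<one>\<^bsub>Iso\<^esub>"] compact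
    by (auto simp: compact_space_def)
  obtain A \<delta> where A: "finite A" "A \<subseteq> M" "\<delta> > 0"
    "\<forall>h\<in>carrier Iso. (\<forall>a\<in>A. d (\<one>\<^bsub>Iso\<^esub> a) (h a) < \<delta>) \<longrightarrow> h \<in> U"
    using Iso_nbhd_base[OF UV(1,2)] by blast
  have "\<bar>f (\<nu> (g x)) - f (\<nu> x)\<bar> < \<epsilon>"
    if g: "g \<in> carrier Iso" and x: "x \<in> M" and close: "\<And>a. a \<in> A \<Longrightarrow> d a (g a) < \<delta>" for g x
  proof -
    have "d (\<one>\<^bsub>Iso\<^esub> a) (g a) < \<delta>" if "a \<in> A" for a
      using close[OF that] A(2) that by (auto simp: Iso_one)
    then have "g \<in> U" using A(4) g by blast
    moreover have "\<nu> x \<in> V" using \<nu> x UV(3) continuous_map_image_subset_topspace by fastforce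
    ultimately have "(g, \<nu> x) \<in> ?W" using UV(4) by blast
    then show ?thesis using equiv[OF g x] by auto
  qed
  then show ?thesis using that A(1-3) by blast
qed

text \<open>Here the group enters: points almost equidistant from each point of \<open>A\<close> are
  exchanged by an isometry that hardly moves \<open>A\<close>, so right uniform continuity becomes
  uniform continuity for the weak uniformity. Boundedness comes from compactness of
  \<open>K\<close>.\<close>

lemma compactification_pullback_in_Gromov_algebra:
  assumes inj: "finitely_injective M d" and complete: "mcomplete"
    and sep: "separable_space mtopology"
    and ec: "equivariant_compactification Iso Iso_topology mtopology (\<lambda>g x. g x) K \<psi> \<nu>"
    and f: "continuous_map K euclideanreal f"
  shows "(\<lambda>x\<in>M. f (\<nu> x)) \<in> Gromov_algebra"
  unfolding Gromov_algebra_iff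
proof (intro conjI allI impI)
  show "(\<lambda>x\<in>M. f (\<nu> x)) \<in> extensional M" by simp
  have compact: "compact_space K" and \<nu>: "continuous_map mtopology K \<nu>"
    using ec by (auto simp: equivariant_compactification_def)
  have "compactin euclideanreal (f ` topspace K)"
    using image_compactin[OF _ f] compact unfolding compact_space_def by blast
  then have "bounded (f ` topspace K)" using compact_imp_bounded by simp
  moreover have "(\<lambda>x\<in>M. f (\<nu> x)) ` M \<subseteq> f ` topspace K"
    using continuous_map_image_subset_topspace[OF \<nu>] by auto
  ultimately show "bounded ((\<lambda>x\<in>M. f (\<nu> x)) ` M)" by (rule bounded_subset)
  fix \<epsilon> :: real assume "\<epsilon> > 0"
  then obtain A \<delta> where A: "finite A" "A \<subseteq> M" "\<delta> > 0"
    "\<And>g x. \<lbrakk>g \<in> carrier Iso; x \<in> M; \<And>a. a \<in> A \<Longrightarrow> d a (g a) < \<delta>\<rbrakk> \<Longrightarrow> \<bar>f (\<nu> (g x)) - f (\<nu> x)\<bar> < \<epsilon>"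
    using equivariant_compactification_right_uniform[OF ec f] by metis
  have "\<bar>f (\<nu> x) - f (\<nu> y)\<bar> < \<epsilon>"
    if xy: "x \<in> M" "y \<in> M" and close: "\<forall>a\<in>A. \<bar>d x a - d y a\<bar> < \<delta> / 2" for x y
  proof -
    obtain g where g: "g \<in> carrier Iso" "g x = y" "\<And>a. a \<in> A \<Longrightarrow> d (g a) a \<le> \<delta> / 2"
      using almost_fixing_isometry[OF inj complete sep A(1,2) xy, of "\<delta> / 2"] close A(3)
      by (metis less_imp_le half_gt_zero)
    have "d a (g a) < \<delta>" if "a \<in> A" for a
      using g(3)[OF that] A(3) commute[of a "g a"] by simp
    then show ?thesis using A(4)[OF g(1) xy(1)] g(2) by (simp add: abs_minus_commute)
  qed
  then show "\<exists>A \<delta>. finite A \<and> A \<subseteq> M \<and> \<delta> > 0 \<and> (\<forall>x\<in>M. \<forall>y\<in>M.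
      (\<forall>a\<in>A. \<bar>d x a - d y a\<bar> < \<delta>) \<longrightarrow> \<bar>(\<lambda>x\<in>M. f (\<nu> x)) x - (\<lambda>x\<in>M. f (\<nu> x)) y\<bar> < \<epsilon>)"
    using A(1-3) by (intro exI[of _ A] exI[of _ "\<delta> / 2"]) simp
qed

section \<open>Factorisation through the Gromov compactification\<close>

text \<open>Embed \<open>K\<close> in a cube by \<open>e\<close>. The coordinates of
  \<open>e\<close> pull back to functions \<open>u i\<close> of the algebra, and evaluating a point
  of the Gromov compactification at all \<open>u i\<close> gives a continuous map \<open>h\<close>
  that agrees with \<open>e\<close> after \<nu> on \<open>M\<close>. By density \<open>h\<close>
  lands in the copy of \<open>K\<close>, and the inverse of \<open>e\<close> finishes the factor
  map.\<close>

lemma Gromov_factor: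
  fixes K :: "'k topology"
  assumes compact: "compact_space K" and Haus: "Hausdorff_space K"
    and \<nu>: "\<nu> \<in> M \<rightarrow> topspace K"
    and pull: "\<And>f. continuous_map K euclideanreal f \<Longrightarrow> (\<lambda>x\<in>M. f (\<nu> x)) \<in> Gromov_algebra"
  shows "compactification_factor mtopology K \<nu> Gromov (gromov_map M d)"
proof -
  have "completely_regular_space K"
    using locally_compact_regular_imp_completely_regular_space
      [OF compact_imp_locally_compact_space[OF compact]] Haus by simp
  then obtain I :: "('k \<Rightarrow> real) set" and e
    where e: "embedding_map K (product_topology (\<lambda>_. top_of_set {0..1::real}) I) e"
    by (rule completely_regular_space_cube_embedding[OF _ Haus])
  let ?C = "product_topology (\<lambda>_. top_of_set {0..1::real}) I"
  let ?E = "e ` topspace K"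
  have C: "?C = subtopology (product_reals I) (\<Pi>\<^sub>E i\<in>I. {0..1})"
    by (simp add: subtopology_product_topology)
  obtain e' where e': "homeomorphic_maps K (subtopology ?C ?E) e e'"
    using e unfolding embedding_map_def homeomorphic_map_maps by blast
  have e_cont: "continuous_map K ?C e"
    using e' by (simp add: homeomorphic_maps_def continuous_map_in_subtopology)
  then have e_cont': "continuous_map K (product_reals I) e"
    unfolding C by (simp add: continuous_map_in_subtopology)
  have E: "?E \<subseteq> (\<Pi>\<^sub>E i\<in>I. {0..1})"
    using continuous_map_image_subset_topspace[OF e_cont] by simp
  then have sub: "subtopology ?C ?E = subtopology (product_reals I) ?E"
    unfolding C by (simp add: subtopology_subtopology inf.absorb2)
  \<comment> \<open>Compactness makes the copy of \<open>K\<close> closed even in the full product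
    of lines, so the closure of the image of \<open>M\<close> cannot leave it.\<close>
  have "compactin (product_reals I) ?E"
    using image_compactin[OF _ e_cont'] compact unfolding compact_space_def by blast
  then have closed: "closedin (product_reals I) ?E"
    by (intro compactin_imp_closedin) (simp_all add: Hausdorff_space_product_topology)
  define u where "u i = (\<lambda>x\<in>M. e (\<nu> x) i)" for i
  have u: "u i \<in> Gromov_algebra" if "i \<in> I" for i
    unfolding u_def
    by (rule pull) (use e_cont' that in \<open>auto simp: continuous_map_componentwise\<close>)
  define h where "h p = (\<lambda>i\<in>I. p (u i))" for p :: "('a \<Rightarrow> real) \<Rightarrow> real"
  have h_cont: "continuous_map Gromov (product_reals I) h"
    unfolding continuous_map_componentwise
  proof (intro conjI ballI)
    show "h ` topspace Gromov \<subseteq> extensional I" by (auto simp: h_def)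
    show "continuous_map Gromov euclideanreal (\<lambda>p. h p i)" if "i \<in> I" for i
      using Gromov_eval[OF u[OF that]] that by (simp add: h_def)
  qed
  have h_map: "h (gromov_map M d x) = e (\<nu> x)" if x: "x \<in> M" for x
  proof
    fix i
    have "e (\<nu> x) \<in> ?E" using \<nu> x by blast
    then have "e (\<nu> x) \<in> extensional I" using E by (auto simp: PiE_iff)
    then show "h (gromov_map M d x) i = e (\<nu> x) i"
      using gromov_map_apply[OF u, of i x] x by (cases "i \<in> I") (auto simp: h_def u_def extensional_def)
  qed
  have "h ` topspace Gromov \<subseteq> product_reals I closure_of (h ` (gromov_map M d ` M))"
    using continuous_map_image_closure_subset[OF h_cont] Gromov_dense by metis
  also have "\<dots> \<subseteq> ?E"
    using h_map \<nu> by (intro closure_of_minimal closed) auto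
  finally have "continuous_map Gromov (subtopology ?C ?E) h"
    unfolding sub using h_cont by (auto simp: continuous_map_in_subtopology)
  then have "continuous_map Gromov K (e' \<circ> h)"
    by (rule continuous_map_compose) (use e' in \<open>simp add: homeomorphic_maps_def\<close>)
  moreover have "(e' \<circ> h) (gromov_map M d x) = \<nu> x" if "x \<in> topspace mtopology" for x
    using that h_map[of x] \<nu> e' by (auto simp: homeomorphic_maps_def)
  ultimately show ?thesis unfolding compactification_factor_def by blast
qed

section \<open>A sequence without convergent subsequence\<close>

text \<open>The function depends on \<open>d x z\<close> alone, in a 1-Lipschitz way, so the single
  base point \<open>z\<close> and \<delta> equal to \<epsilon> suffice.\<close>

lemma Gromov_algebra_radial:
  assumes z: "z \<in> M" and S: "S \<noteq> {}"
  shows "(\<lambda>x\<in>M. min 1 (infdist (d x z) S)) \<in> Gromov_algebra"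
  unfolding Gromov_algebra_iff
proof (intro conjI allI impI)
  show "(\<lambda>x\<in>M. min 1 (infdist (d x z) S)) \<in> extensional M" by simp
  show "bounded ((\<lambda>x\<in>M. min 1 (infdist (d x z) S)) ` M)"
    by (rule bounded_subset[of "{0..1}"]) (auto simp: infdist_nonneg)
  fix \<epsilon> :: real assume \<epsilon>: "\<epsilon> > 0"
  have "\<bar>min 1 (infdist s S) - min 1 (infdist t S)\<bar> \<le> \<bar>s - t\<bar>" for s t :: real
    using infdist_triangle_abs[of s S t] by (auto simp: dist_real_def min_def)
  then show "\<exists>A \<delta>. finite A \<and> A \<subseteq> M \<and> \<delta> > 0 \<and> (\<forall>x\<in>M. \<forall>y\<in>M.
      (\<forall>a\<in>A. \<bar>d x a - d y a\<bar> < \<delta>) \<longrightarrow>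
      \<bar>(\<lambda>x\<in>M. min 1 (infdist (d x z) S)) x - (\<lambda>x\<in>M. min 1 (infdist (d x z) S)) y\<bar> < \<epsilon>)"
    using z \<epsilon> by (intro exI[of _ "{z}"] exI[of _ \<epsilon>]) (auto intro: le_less_trans)
qed

lemma unbounded_sequence:
  assumes "\<not> mbounded M" and z: "z \<in> M"
  obtains x :: "nat \<Rightarrow> 'a" where "\<And>n. x n \<in> M" "\<And>n. d (x (Suc n)) z \<ge> d (x n) z + 1"
proof -
  have far: "\<exists>y\<in>M. d y z \<ge> B" for B
  proof (rule ccontr)
    assume "\<not> ?thesis"
    then have "M \<subseteq> mcball z B" using z commute by (fastforce simp: not_le)
    then show False using assms(1) unfolding mbounded_def by blast
  qed
  have "\<exists>x. \<forall>n. x n \<in> M \<and> d (x (Suc n)) z \<ge> d (x n) z + 1"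
    by (rule dependent_nat_choice[where P = "\<lambda>_ x. x \<in> M" and Q = "\<lambda>_ x y. d y z \<ge> d x z + 1"])
      (use z far in blast)+
  then show ?thesis using that by blast
qed

text \<open>A compact metrizable space is sequentially compact, so it is enough to contradict the
  convergence of a subsequence of the images of a sequence that runs off to infinity.\<close>

theorem Gromov_not_metrizable:
  assumes unbounded: "\<not> mbounded M"
  shows "\<not> metrizable_space Gromov"
proof
  assume "metrizable_space Gromov"
  then obtain N D where "Metric_space N D" and G: "Gromov = Metric_space.mtopology N D"
    unfolding metrizable_space_def by blast
  then interpret N: Metric_space N D by blast
  have N: "topspace Gromov = N" using G by simp
  have "M \<noteq> {}" using unbounded unfolding mbounded_def by blast
  then obtain z where z: "z \<in> M" by blast
  obtain x :: "nat \<Rightarrow> 'a" where x: "\<And>n. x n \<in> M" "\<And>n. d (x (Suc n)) z \<ge> d (x n) z + 1"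
    using unbounded_sequence[OF unbounded z] by blast
  have "range (\<lambda>n. gromov_map M d (x n)) \<subseteq> N" using gromov_map_in_topspace x(1) N by blast
  then obtain l r where r: "strict_mono (r :: nat \<Rightarrow> nat)"
    and lim: "limitin Gromov ((\<lambda>n. gromov_map M d (x n)) \<circ> r) l sequentially"
    using Gromov_compact unfolding G N.compact_space_sequentially by blast
  define t where "t n = d (x (r n)) z" for n
  \<comment> \<open>Summing the single gaps shows that they survive in every subsequence.\<close>
  have gap: "d (x n) z \<ge> d (x m) z + real (n - m)" if "m \<le> n" for m n
    using that
  proof (induction n rule: dec_induct)
    case (step n)
    then show ?case using x(2)[of n] by (simp add: Suc_diff_le)
  qed simp
  have t1: "t n \<ge> t m + 1" if "m < n" for m n
    using gap[of "r m" "r n"] strict_monoD[OF r that] unfolding t_def by linarith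
  have t: "\<bar>t m - t n\<bar> \<ge> 1" if "m \<noteq> n" for m n
    using t1[of m n] t1[of n m] that by (cases m n rule: linorder_cases) auto
  \<comment> \<open>The set of distances to \<open>z\<close> along the even terms. Only after the
    subsequence is fixed can this set, and with it \<open>f\<close>, be chosen.\<close>
  let ?S = "range (\<lambda>k. t (2 * k))"
  define f where "f = (\<lambda>x\<in>M. min 1 (infdist (d x z) ?S))"
  have f: "f \<in> Gromov_algebra" unfolding f_def by (rule Gromov_algebra_radial[OF z]) blast
  have f0: "f (x (r (2 * k))) = 0" for k
    using x(1) by (simp add: f_def t_def[symmetric])
  have f1: "f (x (r (2 * k + 1))) = 1" for k
  proof -
    \<comment> \<open>An odd term has distance value at least 1 away from every even one, so the
      truncation makes \<open>f\<close> exactly 1 there.\<close>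
    have "1 \<le> infdist (t (2 * k + 1)) ?S"
      unfolding infdist_def
      by (auto intro!: cINF_greatest simp: dist_real_def) (metis t double_not_eq_Suc_double)
    then show ?thesis using x(1) by (simp add: f_def t_def)
  qed
  have "limitin euclideanreal ((\<lambda>p. p f) \<circ> ((\<lambda>n. gromov_map M d (x n)) \<circ> r)) (l f) sequentially"
    by (rule continuous_map_limit[OF Gromov_eval[OF f] lim])
  then have L: "(\<lambda>n. f (x (r n))) \<longlonglongrightarrow> l f" by (simp add: o_def gromov_map_apply[OF f])
  have "(\<lambda>k. f (x (r (2 * k)))) \<longlonglongrightarrow> l f"
    using LIMSEQ_subseq_LIMSEQ[OF L, of "\<lambda>k. 2 * k"] by (simp add: strict_mono_def o_def)
  then have "l f = 0" unfolding f0 by (simp add: LIMSEQ_const_iff)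
  moreover have "(\<lambda>k. f (x (r (2 * k + 1)))) \<longlonglongrightarrow> l f"
    using LIMSEQ_subseq_LIMSEQ[OF L, of "\<lambda>k. 2 * k + 1"] by (simp add: strict_mono_def o_def)
  then have "l f = 1" unfolding f1 by (simp add: LIMSEQ_const_iff)
  ultimately show False by simp
qed

theorem Gromov_greatest:
  assumes "finitely_injective M d" "mcomplete" "separable_space mtopology"
  shows "greatest_equivariant_compactification TYPE('k) Iso Iso_topology mtopology (\<lambda>g x. g x)
    Gromov Gromov_action (gromov_map M d)"
  unfolding greatest_equivariant_compactification_def
proof (intro conjI allI impI)
  show "equivariant_compactification Iso Iso_topology mtopology (\<lambda>g x. g x) Gromov Gromov_action
      (gromov_map M d)"
    by (rule equivariant_compactification_Gromov)
  fix K :: "'k topology" and \<psi> \<nu>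
  assume ec: "equivariant_compactification Iso Iso_topology mtopology (\<lambda>g x. g x) K \<psi> \<nu>"
  then have K: "compact_space K" "Hausdorff_space K" "continuous_map mtopology K \<nu>"
    by (simp_all add: equivariant_compactification_def)
  show "compactification_factor mtopology K \<nu> Gromov (gromov_map M d)"
  proof (rule Gromov_factor[OF K(1,2)])
    show "\<nu> \<in> M \<rightarrow> topspace K" using continuous_map_image_subset_topspace[OF K(3)] by auto
    show "(\<lambda>x\<in>M. f (\<nu> x)) \<in> Gromov_algebra" if "continuous_map K euclideanreal f" for f
      by (rule compactification_pullback_in_Gromov_algebra[OF assms ec that])
  qed
qed

end

text \<open>Two types of points occur because factor maps are needed in both directions. Maximality
  of the Gromov compactification is stated over \<open>'k\<close>, the type of points of
  \<open>B\<close>; maximality of \<open>B\<close> is assumed over the type of points of the Gromov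
  compactification, to which it is applied.\<close>

theorem theorem3p7:
  fixes M :: "'a set" and d :: "'a \<Rightarrow> 'a \<Rightarrow> real"
  assumes "urysohn_space M d"
  shows "(\<exists>\<psi>. greatest_equivariant_compactification TYPE('k)
                (isometry_group M d) (isometry_group_topology M d)
                (Metric_space.mtopology M d) (\<lambda>g x. g x)
                (gromov_compactification M d) \<psi> (gromov_map M d))
       \<and> (\<forall>(B::'k topology) \<psi> \<beta>.
            greatest_equivariant_compactification TYPE(('a \<Rightarrow> real) \<Rightarrow> real)
                (isometry_group M d) (isometry_group_topology M d)
                (Metric_space.mtopology M d) (\<lambda>g x. g x) B \<psi> \<beta>
            \<longrightarrow> equivalent_compactifications (Metric_space.mtopology M d)
                  B \<beta> (gromov_compactification M d) (gromov_map M d))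
       \<and> \<not> metrizable_space (gromov_compactification M d)"
proof -
  interpret Metric_space M d using assms by (simp add: urysohn_space_def)
  have U: "finitely_injective M d" "mcomplete" "separable_space mtopology" "\<not> mbounded M"
    using assms by (simp_all add: urysohn_space_def)
  note greatest = Gromov_greatest[OF U(1-3), where 'k = 'k]
  have "equivalent_compactifications mtopology B \<beta> Gromov (gromov_map M d)"
    if B: "greatest_equivariant_compactification TYPE(('a \<Rightarrow> real) \<Rightarrow> real)
      Iso Iso_topology mtopology (\<lambda>g x. g x) B \<psi> \<beta>" for B :: "'k topology" and \<psi> \<beta>
    unfolding equivalent_compactifications_def
  proof
    show "compactification_factor mtopology B \<beta> Gromov (gromov_map M d)"
      using greatest B unfolding greatest_equivariant_compactification_def by blast
    show "compactification_factor mtopology Gromov (gromov_map M d) B \<beta>"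
      using equivariant_compactification_Gromov B
      unfolding greatest_equivariant_compactification_def by blast
  qed
  then show ?thesis using greatest Gromov_not_metrizable[OF U(4)] by blast
qed

end
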